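(* Let $(X,\mu)$ be a connected weighted graph with bounded geometry and $\sup_{x\in X}\sum_{y\in X}\mu(x,y)<+\infty$. Let $\{X_n\}_{n\in\mathbb N}$ be a sequence of finite subsets of $X$ with $X_n\subseteq X_{n+1}$ for all $n$ and $\bigcup_n X_n=X$, and let ${}_n\mu:=\mu|_{X_n\times X_n}$. Let $\{(Y_n,\mu_n)\}_{n\in\mathbb N}$ be a sequence of connected weighted graphs with $X_n\subseteq Y_n\subseteq X$ for all $n$. Suppose that $\mu_n(x,y)\le\mu(x,y)$ for all $n\in\mathbb N$ and $x,y\in Y_n$, and that $\mu_n(x,y)\to\mu(x,y)$ as $n\to\infty$ for all $x,y\in X$ (note that $\mu_n(x,y)$ is defined for all sufficiently large $n$). If $(X_n,{}_n\mu)$ is connected for every $n\in\mathbb N$, then $\lambda_s(Y_n,\mu_n)\ge\lambda_s(X,\mu)$ for all $n$ and $$\lim_{n\to\infty}\lambda_s(Y_n,\mu_n)=\lambda_s(X,\mu).$$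
   Context: A weighted graph $(X,\mu)$ is a set $X$ with a function $\mu:X\times X\to[0,+\infty)$; the (possibly oriented) edges are the pairs $(x,y)$ with $\mu(x,y)>0$. Bounded geometry means $\sup_{x}|\{y:\mu(x,y)>0\}|<+\infty$. Connected means that for all $x,y$ there is $n$ with $\mu^{(n)}(x,y)>0$, where $\mu^{(n)}$ is the $n$-th power of the matrix $\mu$. For $\lambda>0$, the branching random walk (BRW) on $(X,\mu)$ is the continuous-time Markov process $\{\eta_t\}_{t\ge0}$ on $\mathbb N^X$ in which each particle lives an exponential time of parameter 1 and, while alive at $x$, places a new particle at $y$ at rate $\lambda\mu(x,y)$ for each $y$, independently of everything else. The strong critical parameter is $$\lambda_s(X,\mu):=\inf\{\lambda>0:\ \mathbb P^{\delta_{x_0}}(\exists\,\bar t:\ \eta_t(x_0)=0\ \forall t\ge\bar t)<1\},$$ where $x_0\in X$ is a fixed vertex and $\mathbb P^{\delta_{x_0}}$ is the law of the process started with one particle at $x_0$; for a connected graph the value does not depend on $x_0$ ($\inf\emptyset=+\infty$). *)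

theory Defs
  imports "HOL-Probability.Probability"
begin

section \<open>Weighted graphs\<close>

text \<open>
  A weighted graph is a pair of a carrier \<open>X\<close> and a function \<open>\<mu>\<close>. Every definition below looks at
  \<open>\<mu>\<close> on \<open>X \<times> X\<close> only, so \<open>\<mu>\<close> may be arbitrary elsewhere, and for \<open>A \<subseteq> X\<close> the pair \<open>A\<close>, \<open>\<mu>\<close>
  stands for the subgraph \<open>A\<close> with the restriction of \<open>\<mu>\<close> to \<open>A \<times> A\<close>.
\<close>

definition weighted_graph :: "'a set \<Rightarrow> ('a \<Rightarrow> 'a \<Rightarrow> real) \<Rightarrow> bool" where
  "weighted_graph X \<mu> \<longleftrightarrow> (\<forall>x\<in>X. \<forall>y\<in>X. 0 \<le> \<mu> x y)"

definition bounded_geometry :: "'a set \<Rightarrow> ('a \<Rightarrow> 'a \<Rightarrow> real) \<Rightarrow> bool" where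
  "bounded_geometry X \<mu> \<longleftrightarrow>
     (\<exists>K. \<forall>x\<in>X. finite {y\<in>X. \<mu> x y > 0} \<and> card {y\<in>X. \<mu> x y > 0} \<le> K)"

text \<open>The entries of the powers are in \<^typ>\<open>ennreal\<close>, so that the sums over \<open>X\<close> always exist.\<close>

primrec mpower :: "'a set \<Rightarrow> ('a \<Rightarrow> 'a \<Rightarrow> real) \<Rightarrow> nat \<Rightarrow> 'a \<Rightarrow> 'a \<Rightarrow> ennreal" where
  "mpower X \<mu> 0 x y = (if x = y then 1 else 0)"
| "mpower X \<mu> (Suc n) x y = (\<Sum>\<^sub>\<infinity>z\<in>X. ennreal (\<mu> x z) * mpower X \<mu> n z y)"

definition connected_graph :: "'a set \<Rightarrow> ('a \<Rightarrow> 'a \<Rightarrow> real) \<Rightarrow> bool" where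
  "connected_graph X \<mu> \<longleftrightarrow> (\<forall>x\<in>X. \<forall>y\<in>X. \<exists>n. mpower X \<mu> n x y > 0)"


section \<open>The branching random walk\<close>

text \<open>
  The process is built from its genealogy. A potential particle is named by its line of descent,
  most recent birth first: \<open>[]\<close> is the initial particle and \<open>(y, k) # u\<close> is the \<open>k\<close>-th child
  (counting from 0) that \<open>u\<close> places at \<open>y\<close>.
\<close>

type_synonym 'a particle = "('a \<times> nat) list"

text \<open>
  \<open>Life u\<close> is the lifetime of \<open>u\<close>. \<open>Gap u y k\<close> is the waiting time between the births of
  the \<open>(k-1)\<close>-st and the \<open>k\<close>-th child of \<open>u\<close> at \<open>y\<close>, normalised to rate 1: dividing it by
  \<open>r > 0\<close> gives an exponential time of parameter \<open>r\<close>.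
\<close>

datatype 'a clock = Life "'a particle" | Gap "'a particle" 'a nat

definition brw_space :: "('a clock \<Rightarrow> real) measure" where
  "brw_space = Pi\<^sub>M UNIV (\<lambda>_. density lborel (exponential_density 1))"

primrec position :: "'a \<Rightarrow> 'a particle \<Rightarrow> 'a" where
  "position x\<^sub>0 [] = x\<^sub>0"
| "position x\<^sub>0 (c # u) = fst c"

text \<open>
  The age that \<open>u\<close> must reach to produce its \<open>k\<close>-th child at \<open>y\<close>: the \<open>k\<close>-th point of a
  Poisson process of rate \<open>lam * \<mu>(x, y)\<close>, where \<open>x\<close> is the position of \<open>u\<close>. It is meaningful
  only for \<open>\<mu>(x, y) > 0\<close>, which is why \<open>born\<close> has this condition.
\<close>

definition birth_age ::
  "('a \<Rightarrow> 'a \<Rightarrow> real) \<Rightarrow> real \<Rightarrow> 'a \<Rightarrow> ('a clock \<Rightarrow> real) \<Rightarrow> 'a particle \<Rightarrow> 'a \<Rightarrow> nat \<Rightarrow> real" where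
  "birth_age \<mu> lam x\<^sub>0 \<omega> u y k = (\<Sum>j\<le>k. \<omega> (Gap u y j) / (lam * \<mu> (position x\<^sub>0 u) y))"

primrec birth_time ::
  "('a \<Rightarrow> 'a \<Rightarrow> real) \<Rightarrow> real \<Rightarrow> 'a \<Rightarrow> ('a clock \<Rightarrow> real) \<Rightarrow> 'a particle \<Rightarrow> real" where
  "birth_time \<mu> lam x\<^sub>0 \<omega> [] = 0"
| "birth_time \<mu> lam x\<^sub>0 \<omega> (c # u) =
     birth_time \<mu> lam x\<^sub>0 \<omega> u + birth_age \<mu> lam x\<^sub>0 \<omega> u (fst c) (snd c)"

primrec born ::
  "'a set \<Rightarrow> ('a \<Rightarrow> 'a \<Rightarrow> real) \<Rightarrow> real \<Rightarrow> 'a \<Rightarrow> ('a clock \<Rightarrow> real) \<Rightarrow> 'a particle \<Rightarrow> bool" where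
  "born X \<mu> lam x\<^sub>0 \<omega> [] \<longleftrightarrow> True"
| "born X \<mu> lam x\<^sub>0 \<omega> (c # u) \<longleftrightarrow>
     born X \<mu> lam x\<^sub>0 \<omega> u \<and> fst c \<in> X \<and> \<mu> (position x\<^sub>0 u) (fst c) > 0 \<and>
     birth_age \<mu> lam x\<^sub>0 \<omega> u (fst c) (snd c) < \<omega> (Life u)"

definition alive_at ::
  "'a set \<Rightarrow> ('a \<Rightarrow> 'a \<Rightarrow> real) \<Rightarrow> real \<Rightarrow> 'a \<Rightarrow> ('a clock \<Rightarrow> real) \<Rightarrow> real \<Rightarrow> 'a \<Rightarrow> 'a particle set" where
  "alive_at X \<mu> lam x\<^sub>0 \<omega> t x =
     {u. born X \<mu> lam x\<^sub>0 \<omega> u \<and> position x\<^sub>0 u = x \<and>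
         birth_time \<mu> lam x\<^sub>0 \<omega> u \<le> t \<and> t < birth_time \<mu> lam x\<^sub>0 \<omega> u + \<omega> (Life u)}"

text \<open>
  \<open>brw X \<mu> lam x\<^sub>0 \<omega> t x\<close> is \<open>\<eta>\<^sub>t(x)\<close> for the process started with one particle at \<open>x\<^sub>0\<close>. The values
  are in \<^typ>\<open>enat\<close> so that an infinite population (an event of probability zero
  if the row sums of \<open>\<mu>\<close> are bounded) is not counted as \<open>0\<close>, as \<^const>\<open>card\<close> would do.
\<close>

definition brw ::
  "'a set \<Rightarrow> ('a \<Rightarrow> 'a \<Rightarrow> real) \<Rightarrow> real \<Rightarrow> 'a \<Rightarrow> ('a clock \<Rightarrow> real) \<Rightarrow> real \<Rightarrow> 'a \<Rightarrow> enat" where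
  "brw X \<mu> lam x\<^sub>0 \<omega> t x =
     (let A = alive_at X \<mu> lam x\<^sub>0 \<omega> t x in if finite A then enat (card A) else \<infinity>)"

text \<open>
  The base vertex \<open>x\<^sub>0\<close> is explicit. Non-measurable sets have measure 0 in Isabelle; the event below
  is measurable when \<open>X\<close> is countable, as it is for connected graphs with bounded geometry.
  If no \<open>lam\<close> qualifies, the infimum is \<open>\<infinity>\<close>.
\<close>

definition strong_critical :: "'a set \<Rightarrow> ('a \<Rightarrow> 'a \<Rightarrow> real) \<Rightarrow> 'a \<Rightarrow> ereal" where
  "strong_critical X \<mu> x\<^sub>0 =
     Inf {ereal lam | lam. lam > 0 \<and>
       \<P>(\<omega> in brw_space. \<exists>t'\<ge>0. \<forall>t\<ge>t'. brw X \<mu> lam x\<^sub>0 \<omega> t x\<^sub>0 = 0) < 1}"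

end

theory Submission
  imports Defs
begin

text \<open>
  The strong critical parameter is determined by the powers of \<open>\<mu>\<close>: it is the infimum of the
  \<open>lam > 0\<close> such that \<open>lam ^ n * \<mu>\<^sup>(\<^sup>n\<^sup>)(x, x) > 1\<close> for some \<open>n\<close>. Indeed \<open>lam ^ n * \<mu>\<^sup>(\<^sup>n\<^sup>)(x, x)\<close> is the
  expected number of particles of the \<open>n\<close>-th generation at \<open>x\<close>. If it is at most 1 for all \<open>n\<close>, then for
  every smaller rate the expected number of particles ever born at \<open>x\<close> is finite. If it exceeds 1 for
  some \<open>n\<close>, then the generations \<open>n, 2n, 3n, \<dots>\<close> contain a supercritical Galton--Watson process
  of particles at \<open>x\<close>, and since only finitely many of them are born in bounded time, \<open>x\<close> is occupied at
  arbitrarily late times.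

  Given this, the theorem is elementary: the entries of the powers are monotone in the graph, by
  connectedness the infimum does not depend on \<open>x\<close>, and by bounded geometry an entry of a power is a
  finite sum over paths, so that \<open>lam ^ n * \<mu>\<^sup>(\<^sup>n\<^sup>)(x, x) > 1\<close> passes to the approximating graphs.
\<close>


section \<open>Powers of a weighted graph\<close>

lemma ennreal_summable_on [simp]: "(f :: 'b \<Rightarrow> ennreal) summable_on A"
  by (simp add: nonneg_summable_on_complete)

text \<open>Transfers \<open>infsum\<close> to the counting measure, where Tonelli and the
  extraction of constant factors are available. An infinite \<open>A\<close> is enumerated, which
  turns both sides into the same series.\<close>

lemma infsum_eq_nn_integral_count_space:
  fixes f :: "'b \<Rightarrow> ennreal"
  assumes "countable A"
  shows "infsum f A = (\<integral>\<^sup>+x. f x \<partial>count_space A)"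
proof (cases "finite A")
  case True
  then show ?thesis by (simp add: nn_integral_count_space_finite)
next
  case False
  have b: "bij_betw (from_nat_into A) UNIV A"
    using assms False by (rule bij_betw_from_nat_into)
  have "infsum f A = infsum (\<lambda>n. f (from_nat_into A n)) UNIV"
    by (rule infsum_reindex_bij_betw[OF b, symmetric])
  also have "\<dots> = (\<Sum>n. f (from_nat_into A n))"
    by (rule sums_unique[OF has_sum_imp_sums[OF has_sum_infsum]]) simp
  also have "\<dots> = (\<integral>\<^sup>+n. f (from_nat_into A n) \<partial>count_space UNIV)"
    by (simp add: nn_integral_count_space_nat)
  also have "\<dots> = (\<integral>\<^sup>+x. f x \<partial>count_space A)"
    by (rule nn_integral_bij_count_space[OF b])
  finally show ?thesis .
qed

lemma infsum_cmult_ennreal: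
  fixes f :: "'b \<Rightarrow> ennreal"
  assumes "countable A"
  shows "(\<Sum>\<^sub>\<infinity>x\<in>A. c * f x) = c * infsum f A"
  by (simp add: infsum_eq_nn_integral_count_space[OF assms] nn_integral_cmult)

section \<open>Monotonicity, products and growth of the powers\<close>

lemma mpower_mono:
  assumes "Y \<subseteq> X" and "\<And>x y. x \<in> Y \<Longrightarrow> y \<in> Y \<Longrightarrow> \<nu> x y \<le> \<mu> x y" and "x \<in> Y"
  shows "mpower Y \<nu> n x y \<le> mpower X \<mu> n x y"
  using \<open>x \<in> Y\<close>
proof (induction n arbitrary: x)
  case (Suc n)
  then show ?case using assms(1,2)
    by (auto intro!: infsum_mono_neutral mult_mono ennreal_leI)
qed simp

text \<open>Entries of the powers are total weights of walks: a walk of \<open>m\<close> steps to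
  \<open>z\<close> continued by a walk of \<open>n\<close> steps is one of the walks of
  \<open>m + n\<close> steps.\<close>

lemma mpower_add_ge:
  assumes "countable X" and "z \<in> X"
  shows "mpower X \<mu> m x z * mpower X \<mu> n z y \<le> mpower X \<mu> (m + n) x y"
proof (induction m arbitrary: x)
  case (Suc m)
  have "mpower X \<mu> (Suc m) x z * mpower X \<mu> n z y =
      (\<Sum>\<^sub>\<infinity>w\<in>X. mpower X \<mu> n z y * (ennreal (\<mu> x w) * mpower X \<mu> m w z))"
    by (simp add: infsum_cmult_ennreal[OF assms(1)] mult.commute)
  also have "\<dots> \<le> (\<Sum>\<^sub>\<infinity>w\<in>X. ennreal (\<mu> x w) * mpower X \<mu> (m + n) w y)"
    by (intro infsum_mono) (use Suc in \<open>auto simp: ac_simps intro!: mult_left_mono\<close>)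
  finally show ?case by simp
qed (use assms in simp)

lemma mpower_power_ge:
  assumes "countable X" and "x \<in> X"
  shows "mpower X \<mu> n x x ^ k \<le> mpower X \<mu> (n * k) x x"
proof (induction k)
  case (Suc k)
  have "mpower X \<mu> n x x ^ Suc k \<le> mpower X \<mu> n x x * mpower X \<mu> (n * k) x x"
    using Suc by (simp add: mult_left_mono)
  also have "\<dots> \<le> mpower X \<mu> (n + n * k) x x" by (rule mpower_add_ge[OF assms])
  finally show ?case by simp
qed simp

text \<open>Tonelli moves the sum over the endpoint inside the sum over the first step; every step
  then costs a factor of at most \<open>K\<close>.\<close>

lemma mpower_sum_le:
  assumes "countable X" and "x \<in> X"
    and "\<And>x. x \<in> X \<Longrightarrow> (\<Sum>\<^sub>\<infinity>y\<in>X. ennreal (\<mu> x y)) \<le> K"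
  shows "(\<Sum>\<^sub>\<infinity>y\<in>X. mpower X \<mu> n x y) \<le> K ^ n"
  using \<open>x \<in> X\<close>
proof (induction n arbitrary: x)
  case 0
  have "(\<Sum>\<^sub>\<infinity>y\<in>X. mpower X \<mu> 0 x y) = (\<Sum>\<^sub>\<infinity>y\<in>{x}. (1::ennreal))"
    by (rule infsum_cong_neutral) (use 0 in auto)
  then show ?case by simp
next
  case (Suc n)
  note nn = infsum_eq_nn_integral_count_space[OF assms(1)]
  have "(\<Sum>\<^sub>\<infinity>y\<in>X. mpower X \<mu> (Suc n) x y) =
     (\<Sum>\<^sub>\<infinity>z\<in>X. \<Sum>\<^sub>\<infinity>y\<in>X. ennreal (\<mu> x z) * mpower X \<mu> n z y)"
    unfolding nn mpower.simps by (rule nn_integral_count_space_nn_integral[OF assms(1)]) simp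
  also have "\<dots> = (\<Sum>\<^sub>\<infinity>z\<in>X. ennreal (\<mu> x z) * (\<Sum>\<^sub>\<infinity>y\<in>X. mpower X \<mu> n z y))"
    by (simp add: infsum_cmult_ennreal[OF assms(1)])
  also have "\<dots> \<le> (\<Sum>\<^sub>\<infinity>z\<in>X. K ^ n * ennreal (\<mu> x z))"
    by (intro infsum_mono) (use Suc.IH in \<open>auto simp: mult.commute[of "K ^ n"] intro!: mult_left_mono\<close>)
  also have "\<dots> \<le> K ^ n * K"
    using assms(3)[OF Suc.prems] by (auto simp: infsum_cmult_ennreal[OF assms(1)] intro!: mult_left_mono)
  finally show ?case by (simp add: mult.commute)
qed

lemma mpower_le_power:
  assumes "countable X" and "x \<in> X" and "y \<in> X"
    and "\<And>x. x \<in> X \<Longrightarrow> (\<Sum>\<^sub>\<infinity>y\<in>X. ennreal (\<mu> x y)) \<le> K"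
  shows "mpower X \<mu> n x y \<le> K ^ n"
proof -
  have "mpower X \<mu> n x y = infsum (mpower X \<mu> n x) {y}" by simp
  also have "\<dots> \<le> infsum (mpower X \<mu> n x) X"
    by (rule infsum_mono_neutral) (use assms in auto)
  also have "\<dots> \<le> K ^ n" by (rule mpower_sum_le[OF assms(1,2,4)])
  finally show ?thesis .
qed

text \<open>By supermultiplicativity of the diagonal entries, for \<open>lam > 0\<close> and a
  vertex of a countable graph this says that \<open>lam\<close> exceeds the reciprocal of the limsup
  of their \<open>n\<close>-th roots. The witness \<open>n\<close> is never 0, where the product is
  exactly 1.\<close>

definition supercritical :: "'a set \<Rightarrow> ('a \<Rightarrow> 'a \<Rightarrow> real) \<Rightarrow> 'a \<Rightarrow> real \<Rightarrow> bool" where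
  "supercritical X \<mu> x lam \<longleftrightarrow> (\<exists>n. 1 < ennreal (lam ^ n) * mpower X \<mu> n x x)"

lemma supercritical_mono:
  assumes "Y \<subseteq> X" and "\<And>x y. x \<in> Y \<Longrightarrow> y \<in> Y \<Longrightarrow> \<nu> x y \<le> \<mu> x y" and "x \<in> Y"
    and "supercritical Y \<nu> x lam"
  shows "supercritical X \<mu> x lam"
proof -
  obtain n where "1 < ennreal (lam ^ n) * mpower Y \<nu> n x x"
    using assms(4) by (auto simp: supercritical_def)
  also have "\<dots> \<le> ennreal (lam ^ n) * mpower X \<mu> n x x"
    by (intro mult_left_mono mpower_mono assms zero_le)
  finally show ?thesis by (auto simp: supercritical_def)
qed

text \<open>Loops at \<open>y\<close> arise by walking to \<open>x\<close>, running \<open>k\<close>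
  times through loops at \<open>x\<close> of weight above 1, and walking back. The two connecting
  walks contribute a fixed positive factor, which is outweighed for large \<open>k\<close>.\<close>

lemma supercritical_base_change:
  assumes "countable X" and "connected_graph X \<mu>" and "x \<in> X" and "y \<in> X" and "lam > 0"
    and "supercritical X \<mu> x lam"
  shows "supercritical X \<mu> y lam"
proof -
  obtain n where n: "1 < ennreal (lam ^ n) * mpower X \<mu> n x x"
    using assms(6) by (auto simp: supercritical_def)
  obtain a b where ab: "mpower X \<mu> a y x > 0" "mpower X \<mu> b x y > 0"
    using assms(2-4) unfolding connected_graph_def by blast
  define q where "q = ennreal (lam ^ n) * mpower X \<mu> n x x"
  define c where "c = ennreal (lam ^ a) * mpower X \<mu> a y x * (ennreal (lam ^ b) * mpower X \<mu> b x y)"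
  have "c > 0" using ab \<open>lam > 0\<close> by (auto simp: c_def ennreal_zero_less_mult_iff)
  \<comment> \<open>\<open>q\<close> and \<open>c\<close> may be infinite, so the Archimedean
    argument uses reals \<open>r\<close> and \<open>d\<close> strictly below them.\<close>
  have dense_real: "\<exists>r. a < ennreal r \<and> ennreal r < b" if ab: "a < b" for a b :: ennreal
  proof -
    obtain t where t: "a < t" "t < b" using dense[OF ab] by blast
    then show ?thesis by (cases t) auto
  qed
  obtain r where r: "ennreal 1 < ennreal r" "ennreal r < q"
    using dense_real[OF n] unfolding q_def by auto
  obtain d where d: "ennreal 0 < ennreal d" "ennreal d < c"
    using dense_real[OF \<open>c > 0\<close>] by auto
  have rd: "1 < r" "0 < d"
    using r(1) d(1) by (simp_all only: ennreal_less_iff[OF zero_le_one] ennreal_less_iff[OF order_refl])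
  obtain k where k: "1 / d < r ^ k" using real_arch_pow[OF rd(1)] by blast
  have e: "ennreal (lam ^ (a + n * k + b)) = ennreal (lam ^ a) * ennreal (lam ^ n) ^ k * ennreal (lam ^ b)"
    using \<open>lam > 0\<close> by (simp add: power_add power_mult ennreal_mult ennreal_power)
  have "1 < ennreal (r ^ k * d)"
    using k rd by (subst ennreal_1[symmetric], subst ennreal_less_iff) (auto simp: field_simps)
  also have "\<dots> = ennreal r ^ k * ennreal d"
    using rd by (simp add: ennreal_mult ennreal_power)
  also have "\<dots> \<le> q ^ k * c" using r d by (intro mult_mono power_mono) auto
  also have "\<dots> = ennreal (lam ^ (a + n * k + b)) *
      (mpower X \<mu> a y x * mpower X \<mu> n x x ^ k * mpower X \<mu> b x y)"
    unfolding q_def c_def e power_mult_distrib by (simp only: mult.assoc mult.commute mult.left_commute)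
  also have "\<dots> \<le> ennreal (lam ^ (a + n * k + b)) * mpower X \<mu> (a + n * k + b) y y"
  proof (intro mult_left_mono zero_le)
    have "mpower X \<mu> a y x * mpower X \<mu> n x x ^ k * mpower X \<mu> b x y
        \<le> mpower X \<mu> a y x * mpower X \<mu> (n * k) x x * mpower X \<mu> b x y"
      by (intro mult_left_mono mult_right_mono mpower_power_ge assms zero_le)
    also have "\<dots> \<le> mpower X \<mu> (a + n * k) y x * mpower X \<mu> b x y"
      by (intro mult_right_mono mpower_add_ge assms zero_le)
    also have "\<dots> \<le> mpower X \<mu> (a + n * k + b) y y"
      by (intro mpower_add_ge assms)
    finally show "mpower X \<mu> a y x * mpower X \<mu> n x x ^ k * mpower X \<mu> b x y
        \<le> mpower X \<mu> (a + n * k + b) y y" .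
  qed
  finally show ?thesis by (auto simp: supercritical_def)
qed

text \<open>Each step of the recursion sums over the finitely many out-neighbours of
  \<open>x\<close> in \<open>X\<close>, a set that does not depend on \<open>n\<close>, so the limit
  may be taken term by term.\<close>

lemma mpower_tendsto:
  fixes \<mu>s :: "nat \<Rightarrow> 'a \<Rightarrow> 'a \<Rightarrow> real"
  assumes "countable X"
    and "\<And>x. x \<in> X \<Longrightarrow> finite {y \<in> X. \<mu> x y > 0}"
    and "K < \<infinity>" and "\<And>x. x \<in> X \<Longrightarrow> (\<Sum>\<^sub>\<infinity>y\<in>X. ennreal (\<mu> x y)) \<le> K"
    and "\<And>x. x \<in> X \<Longrightarrow> eventually (\<lambda>n. x \<in> Ys n) sequentially"
    and "\<And>n. Ys n \<subseteq> X"
    and "\<And>n x y. x \<in> Ys n \<Longrightarrow> y \<in> Ys n \<Longrightarrow> \<mu>s n x y \<le> \<mu> x y"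
    and "\<And>x y. x \<in> X \<Longrightarrow> y \<in> X \<Longrightarrow> (\<lambda>n. \<mu>s n x y) \<longlonglongrightarrow> \<mu> x y"
    and "x \<in> X" and "y \<in> X"
  shows "(\<lambda>n. mpower (Ys n) (\<mu>s n) N x y) \<longlonglongrightarrow> mpower X \<mu> N x y"
  using \<open>x \<in> X\<close>
proof (induction N arbitrary: x)
  case (Suc N)
  define D where "D = {z \<in> X. \<mu> x z > 0}"
  have D: "finite D" "D \<subseteq> X" using assms(2) Suc.prems by (auto simp: D_def)
  have lim: "(\<lambda>n. \<Sum>z\<in>D. ennreal (\<mu>s n x z) * mpower (Ys n) (\<mu>s n) N z y)
      \<longlonglongrightarrow> (\<Sum>z\<in>D. ennreal (\<mu> x z) * mpower X \<mu> N z y)"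
  proof (intro tendsto_sum tendsto_mult_ennreal)
    fix z assume "z \<in> D"
    then have z: "z \<in> X" using D by auto
    show "(\<lambda>n. ennreal (\<mu>s n x z)) \<longlonglongrightarrow> ennreal (\<mu> x z)"
      using assms(8) Suc.prems z by (intro tendsto_ennrealI)
    show "(\<lambda>n. mpower (Ys n) (\<mu>s n) N z y) \<longlonglongrightarrow> mpower X \<mu> N z y" by (rule Suc.IH[OF z])
    \<comment> \<open>Extended multiplication is discontinuous at \<open>0 * \<infinity>\<close>;
      finiteness of both limits excludes this case.\<close>
    have "mpower X \<mu> N z y \<le> K ^ N"
      using assms(4) by (rule mpower_le_power[OF assms(1) z \<open>y \<in> X\<close>])
    also have "\<dots> < \<infinity>" using \<open>K < \<infinity>\<close> by (simp add: power_less_top_ennreal)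
    finally have fin: "mpower X \<mu> N z y < \<infinity>" .
    show "\<not> ((ennreal (\<mu> x z) = 0 \<and> mpower X \<mu> N z y = \<infinity>) \<or>
        (ennreal (\<mu> x z) = \<infinity> \<and> mpower X \<mu> N z y = 0))"
      using fin by auto
  qed
  have "mpower X \<mu> (Suc N) x y = (\<Sum>\<^sub>\<infinity>z\<in>D. ennreal (\<mu> x z) * mpower X \<mu> N z y)"
    unfolding mpower.simps
    by (rule infsum_cong_neutral) (auto simp: D_def not_less ennreal_neg)
  also have "\<dots> = (\<Sum>z\<in>D. ennreal (\<mu> x z) * mpower X \<mu> N z y)" using D by simp
  finally have X: "mpower X \<mu> (Suc N) x y = \<dots>" .
  \<comment> \<open>Once \<open>Ys n\<close> contains \<open>x\<close> and \<open>D\<close>, its sum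
    reduces to \<open>D\<close>: elsewhere \<open>\<mu>s n x z \<le> \<mu> x z \<le> 0\<close>, and
    \<open>ennreal\<close> sends such weights to 0.\<close>
  have "eventually (\<lambda>n. x \<in> Ys n \<and> (\<forall>z\<in>D. z \<in> Ys n)) sequentially"
    using assms(5) D Suc.prems by (auto simp: eventually_conj_iff eventually_ball_finite_distrib)
  then have "eventually (\<lambda>n. (\<Sum>z\<in>D. ennreal (\<mu>s n x z) * mpower (Ys n) (\<mu>s n) N z y) =
      mpower (Ys n) (\<mu>s n) (Suc N) x y) sequentially"
  proof eventually_elim
    case (elim n)
    have "mpower (Ys n) (\<mu>s n) (Suc N) x y = (\<Sum>\<^sub>\<infinity>z\<in>D. ennreal (\<mu>s n x z) * mpower (Ys n) (\<mu>s n) N z y)"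
      unfolding mpower.simps
    proof (rule infsum_cong_neutral)
      fix z assume z: "z \<in> Ys n - D"
      then have "\<mu>s n x z \<le> 0" using assms(6)[of n] assms(7)[of x n z] elim by (auto simp: D_def)
      then show "ennreal (\<mu>s n x z) * mpower (Ys n) (\<mu>s n) N z y = 0" by (simp add: ennreal_neg)
    qed (use elim in auto)
    then show ?case using D by simp
  qed
  then show ?case unfolding X by (rule Lim_transform_eventually[OF lim])
qed simp


section \<open>The probability space of clocks\<close>

abbreviation exp_law :: "real measure" where
  "exp_law \<equiv> density lborel (exponential_density 1)"

lemma prob_space_exp_law: "prob_space exp_law"
  by (simp add: prob_space_exponential_density)

lemma prob_space_brw: "prob_space (brw_space :: ('a clock \<Rightarrow> real) measure)"
  unfolding brw_space_def by (intro prob_space_PiM prob_space_exp_law)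

lemma space_brw [simp]: "space (brw_space :: ('a clock \<Rightarrow> real) measure) = UNIV"
  by (simp add: brw_space_def space_PiM)

lemma sets_brw: "sets (brw_space :: ('a clock \<Rightarrow> real) measure) = sets (Pi\<^sub>M UNIV (\<lambda>_. borel))"
  unfolding brw_space_def by (intro sets_PiM_cong) auto

lemma measurable_clock [measurable]:
  "(\<lambda>\<omega>. \<omega> i) \<in> borel_measurable (brw_space :: ('a clock \<Rightarrow> real) measure)"
  by (subst measurable_cong_sets[OF sets_brw refl]) simp

text \<open>A pointwise substitute for measurability with respect to the coordinates in
  \<open>I\<close>: measurable maps with disjoint index sets turn out to be independent.\<close>

definition depends_on :: "'i set \<Rightarrow> (('i \<Rightarrow> 'b) \<Rightarrow> 'c) \<Rightarrow> bool" where
  "depends_on I f \<longleftrightarrow> (\<forall>\<omega> \<omega>'. (\<forall>i\<in>I. \<omega> i = \<omega>' i) \<longrightarrow> f \<omega> = f \<omega>')"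

lemma distr_clock: "distr brw_space exp_law (\<lambda>\<omega>. \<omega> i) = exp_law"
  unfolding brw_space_def by (rule distr_PiM_component) (auto intro: prob_space_exp_law)

text \<open>Both maps factor through restrictions of the clocks to disjoint index sets, and disjoint
  subfamilies of independent coordinates are independent.\<close>

lemma indep_var_brw:
  fixes f :: "('a clock \<Rightarrow> real) \<Rightarrow> 'b" and g :: "('a clock \<Rightarrow> real) \<Rightarrow> 'b"
  assumes "f \<in> measurable brw_space N1" and "g \<in> measurable brw_space N2"
    and "depends_on I f" and "depends_on J g" and "I \<inter> J = {}"
  shows "prob_space.indep_var brw_space N1 f N2 g"
proof -
  interpret prob_space "brw_space :: ('a clock \<Rightarrow> real) measure" by (rule prob_space_brw)
  \<comment> \<open>Filling the missing coordinates with 0 makes \<open>f\<close> and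
    \<open>g\<close> functions of the restricted families; the default value is harmless because
    they ignore those coordinates.\<close>
  define ext :: "'a clock set \<Rightarrow> ('a clock \<Rightarrow> real) \<Rightarrow> 'a clock \<Rightarrow> real"
    where "ext I \<eta> i = (if i \<in> I then \<eta> i else 0)" for I \<eta> i
  have ext: "ext I \<in> measurable (Pi\<^sub>M I (\<lambda>_. exp_law)) brw_space" for I
    unfolding brw_space_def
  proof (rule measurable_PiM_single')
    fix i :: "'a clock"
    show "(\<lambda>\<eta>. ext I \<eta> i) \<in> measurable (Pi\<^sub>M I (\<lambda>_. exp_law)) exp_law"
      using measurable_component_singleton[of i I "\<lambda>_. exp_law"]
      by (cases "i \<in> I") (simp_all add: ext_def)
  qed simp
  have "indep_vars (\<lambda>_. exp_law) (\<lambda>i \<omega>. \<omega> i) UNIV"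
  proof (subst indep_vars_iff_distr_eq_PiM)
    show "distr brw_space (\<Pi>\<^sub>M i\<in>UNIV. exp_law) (\<lambda>\<omega>. \<lambda>i\<in>UNIV. \<omega> i) =
        (\<Pi>\<^sub>M i\<in>(UNIV :: 'a clock set). distr brw_space exp_law (\<lambda>\<omega>. \<omega> i))"
      unfolding distr_clock by (simp add: restrict_UNIV flip: brw_space_def)
  qed simp_all
  then have "indep_var (Pi\<^sub>M I (\<lambda>_. exp_law)) (\<lambda>\<omega>. restrict (\<lambda>i. \<omega> i) I)
      (Pi\<^sub>M J (\<lambda>_. exp_law)) (\<lambda>\<omega>. restrict (\<lambda>i. \<omega> i) J)"
    by (rule indep_var_restrict) (use assms(5) in auto)
  then have "indep_var N1 ((f \<circ> ext I) \<circ> (\<lambda>\<omega>. restrict (\<lambda>i. \<omega> i) I))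
      N2 ((g \<circ> ext J) \<circ> (\<lambda>\<omega>. restrict (\<lambda>i. \<omega> i) J))"
    by (rule indep_var_compose)
      (intro measurable_comp[OF ext] assms(1,2))+
  also have "(f \<circ> ext I) \<circ> (\<lambda>\<omega>. restrict (\<lambda>i. \<omega> i) I) = f"
    using assms(3) by (auto simp: depends_on_def fun_eq_iff ext_def)
  also have "(g \<circ> ext J) \<circ> (\<lambda>\<omega>. restrict (\<lambda>i. \<omega> i) J) = g"
    using assms(4) by (auto simp: depends_on_def fun_eq_iff ext_def)
  finally show ?thesis .
qed

text \<open>Independence makes the joint law the product of the marginal laws, so by Tonelli
  \<open>g\<close> may be evaluated at an independent copy of the clocks.\<close>

lemma nn_integral_brw_pair:
  fixes f :: "('a clock \<Rightarrow> real) \<Rightarrow> 'b" and g :: "('a clock \<Rightarrow> real) \<Rightarrow> 'b"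
  assumes f: "f \<in> measurable brw_space N1" and g: "g \<in> measurable brw_space N2"
    and "depends_on I f" and "depends_on J g" and "I \<inter> J = {}"
    and h[measurable]: "h \<in> borel_measurable (N1 \<Otimes>\<^sub>M N2)"
  shows "(\<integral>\<^sup>+\<omega>. h (f \<omega>, g \<omega>) \<partial>brw_space) = (\<integral>\<^sup>+\<omega>. \<integral>\<^sup>+\<omega>'. h (f \<omega>, g \<omega>') \<partial>brw_space \<partial>brw_space)"
proof -
  interpret prob_space "brw_space :: ('a clock \<Rightarrow> real) measure" by (rule prob_space_brw)
  interpret g: prob_space "distr brw_space N2 g" using g by (rule prob_space_distr)
  note [measurable] = f g
  have D: "distr brw_space N1 f \<Otimes>\<^sub>M distr brw_space N2 g = distr brw_space (N1 \<Otimes>\<^sub>M N2) (\<lambda>\<omega>. (f \<omega>, g \<omega>))"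
    using indep_var_brw[OF assms(1-5)] by (simp add: indep_var_distribution_eq)
  have "(\<integral>\<^sup>+\<omega>. h (f \<omega>, g \<omega>) \<partial>brw_space) =
      (\<integral>\<^sup>+p. h p \<partial>distr brw_space (N1 \<Otimes>\<^sub>M N2) (\<lambda>\<omega>. (f \<omega>, g \<omega>)))"
    by (rule nn_integral_distr[symmetric]) auto
  also have "\<dots> = (\<integral>\<^sup>+x. \<integral>\<^sup>+y. h (x, y) \<partial>distr brw_space N2 g \<partial>distr brw_space N1 f)"
    unfolding D[symmetric] by (rule g.nn_integral_fst[symmetric]) simp
  also have "\<dots> = (\<integral>\<^sup>+\<omega>. \<integral>\<^sup>+y. h (f \<omega>, y) \<partial>distr brw_space N2 g \<partial>brw_space)"
    by (rule nn_integral_distr[OF f]) simp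
  also have "\<dots> = (\<integral>\<^sup>+\<omega>. \<integral>\<^sup>+\<omega>'. h (f \<omega>, g \<omega>') \<partial>brw_space \<partial>brw_space)"
  proof (rule nn_integral_cong)
    fix \<omega> :: "'a clock \<Rightarrow> real"
    have "f \<omega> \<in> space N1" using measurable_space[OF f] by simp
    then show "(\<integral>\<^sup>+y. h (f \<omega>, y) \<partial>distr brw_space N2 g) = (\<integral>\<^sup>+\<omega>'. h (f \<omega>, g \<omega>') \<partial>brw_space)"
      by (intro nn_integral_distr[OF g]) simp
  qed
  finally show ?thesis .
qed

lemma nn_integral_brw_mult:
  fixes f g :: "('a clock \<Rightarrow> real) \<Rightarrow> ennreal"
  assumes [measurable]: "f \<in> borel_measurable brw_space" "g \<in> borel_measurable brw_space"
    and "depends_on I f" and "depends_on J g" and "I \<inter> J = {}"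
  shows "(\<integral>\<^sup>+\<omega>. f \<omega> * g \<omega> \<partial>brw_space) = (\<integral>\<^sup>+\<omega>. f \<omega> \<partial>brw_space) * (\<integral>\<^sup>+\<omega>. g \<omega> \<partial>brw_space)"
  using nn_integral_brw_pair[OF assms(1-5), of "\<lambda>(x, y). x * y"]
  by (simp add: nn_integral_cmult nn_integral_multc)

lemma measurable_brw_reindex:
  "(\<lambda>\<omega> i. \<omega> (\<sigma> i)) \<in> measurable brw_space (brw_space :: ('a clock \<Rightarrow> real) measure)"
  unfolding measurable_cong_sets[OF refl sets_brw]
  by (rule measurable_PiM_single') auto

text \<open>An injective relabelling preserves the law of an i.i.d. family. Applied to
  \<open>shift\<close>, this lets the subtree of a particle be treated as a fresh process.\<close>

lemma distr_brw_reindex: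
  fixes \<sigma> :: "'a clock \<Rightarrow> 'a clock"
  assumes "inj \<sigma>"
  shows "distr brw_space brw_space (\<lambda>\<omega> i. \<omega> (\<sigma> i)) = brw_space"
  using distr_PiM_reindex[of UNIV "\<lambda>_::'a clock. exp_law" \<sigma> UNIV] assms prob_space_exp_law
  by (simp add: brw_space_def restrict_UNIV)

lemma nn_integral_brw_reindex:
  fixes f :: "('a clock \<Rightarrow> real) \<Rightarrow> ennreal" and \<sigma> :: "'a clock \<Rightarrow> 'a clock"
  assumes "inj \<sigma>" and "f \<in> borel_measurable brw_space"
  shows "(\<integral>\<^sup>+\<omega>. f (\<lambda>i. \<omega> (\<sigma> i)) \<partial>brw_space) = (\<integral>\<^sup>+\<omega>. f \<omega> \<partial>brw_space)"
proof -
  have "(\<integral>\<^sup>+\<omega>. f \<omega> \<partial>brw_space) = (\<integral>\<^sup>+\<omega>. f \<omega> \<partial>distr brw_space brw_space (\<lambda>\<omega> i. \<omega> (\<sigma> i)))"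
    by (simp add: distr_brw_reindex[OF assms(1)])
  also have "\<dots> = (\<integral>\<^sup>+\<omega>. f (\<lambda>i. \<omega> (\<sigma> i)) \<partial>brw_space)"
    using assms(2) by (intro nn_integral_distr measurable_brw_reindex) simp_all
  finally show ?thesis by simp
qed

section \<open>Exponential clocks and their Laplace transforms\<close>

lemma nn_integral_clock:
  assumes "h \<in> borel_measurable borel"
  shows "(\<integral>\<^sup>+\<omega>. h (\<omega> i) \<partial>brw_space) = (\<integral>\<^sup>+x. ennreal (exponential_density 1 x) * h x \<partial>lborel)"
proof -
  have "(\<integral>\<^sup>+x. h x \<partial>exp_law) = (\<integral>\<^sup>+x. h x \<partial>distr brw_space exp_law (\<lambda>\<omega>. \<omega> i))"
    by (simp only: distr_clock)
  also have "\<dots> = (\<integral>\<^sup>+\<omega>. h (\<omega> i) \<partial>brw_space)"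
    using assms by (intro nn_integral_distr) auto
  finally show ?thesis using assms by (simp add: nn_integral_density)
qed

lemma distributed_clock:
  "distributed brw_space lborel (\<lambda>\<omega>. \<omega> i) (exponential_density 1)"
  unfolding distributed_def
  using distr_clock[of i] by (auto cong: distr_cong)

text \<open>Exponential tilting: \<open>exp (- c * x)\<close> times the density of parameter 1 is
  \<open>1 / (1 + c)\<close> times the density of parameter \<open>1 + c\<close>.\<close>

lemma nn_integral_clock_exp:
  assumes "0 \<le> c"
  shows "(\<integral>\<^sup>+\<omega>. ennreal (exp (- c * \<omega> i)) \<partial>brw_space) = ennreal (1 / (1 + c))"
proof -
  interpret l: prob_space "density lborel (exponential_density (1 + c))"
    using assms by (intro prob_space_exponential_density) simp
  have e: "exponential_density 1 x * exp (- c * x) = 1 / (1 + c) * exponential_density (1 + c) x" for x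
  proof -
    have "exponential_density (1 + c) x = (1 + c) * (exponential_density 1 x * exp (- c * x))"
      by (simp add: exponential_density_def exp_add[symmetric] algebra_simps)
    then show ?thesis using assms by simp
  qed
  have "(\<integral>\<^sup>+\<omega>. ennreal (exp (- c * \<omega> i)) \<partial>brw_space) =
      (\<integral>\<^sup>+x. ennreal (exponential_density 1 x) * ennreal (exp (- c * x)) \<partial>lborel)"
    by (rule nn_integral_clock) simp
  also have "\<dots> = (\<integral>\<^sup>+x. ennreal (1 / (1 + c)) * ennreal (exponential_density (1 + c) x) \<partial>lborel)"
    using e assms by (intro nn_integral_cong) (simp add: ennreal_mult[symmetric] exponential_density_nonneg)
  also have "\<dots> = ennreal (1 / (1 + c)) * emeasure (density lborel (exponential_density (1 + c))) UNIV"
    by (simp add: nn_integral_cmult emeasure_density)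
  also have "\<dots> = ennreal (1 / (1 + c))" using l.emeasure_space_1 by simp
  finally show ?thesis .
qed

lemma nn_integral_clock_tail:
  fixes i :: "'a clock"
  assumes "0 \<le> a"
  shows "(\<integral>\<^sup>+\<omega>. indicator {a<..} (\<omega> i) \<partial>brw_space) = ennreal (exp (- a))"
proof -
  interpret prob_space "brw_space :: ('a clock \<Rightarrow> real) measure" by (rule prob_space_brw)
  have [measurable]: "{\<omega>. a < \<omega> i} \<in> sets brw_space"
    using measurable_clock[of i] unfolding borel_measurable_iff_greater by simp
  have "(\<integral>\<^sup>+\<omega>. indicator {a<..} (\<omega> i) \<partial>brw_space) = (\<integral>\<^sup>+\<omega>. indicator {\<omega>. a < \<omega> i} \<omega> \<partial>brw_space)"
    by (simp add: indicator_def)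
  also have "\<dots> = emeasure brw_space {\<omega> \<in> space brw_space. a < \<omega> i}" by simp
  also have "\<dots> = ennreal (exp (- a))"
    using exponential_distributedD_gt[OF distributed_clock[of i] assms] by (simp add: emeasure_eq_measure)
  finally show ?thesis .
qed

lemma AE_clock_pos: "AE \<omega> in brw_space. 0 < \<omega> (i :: 'a clock)"
proof -
  interpret prob_space "brw_space :: ('a clock \<Rightarrow> real) measure" by (rule prob_space_brw)
  have "{\<omega> \<in> space brw_space. 0 < \<omega> i} \<in> events" by measurable
  then show ?thesis
    using exponential_distributedD_gt[OF distributed_clock[of i], of 0] prob_Collect_eq_1 by auto
qed

text \<open>The sum of \<open>k + 1\<close> independent standard exponentials has a Gamma law; the
  induction splits off the last gap, which no earlier summand uses.\<close>

lemma nn_integral_gap_sum: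
  fixes u :: "'a particle"
  assumes "0 \<le> c"
  shows "(\<integral>\<^sup>+\<omega>. ennreal (exp (- c * (\<Sum>j\<le>k. \<omega> (Gap u y j)))) \<partial>brw_space) = ennreal ((1 / (1 + c)) ^ Suc k)"
proof (induction k)
  case 0
  then show ?case using nn_integral_clock_exp[OF assms] by simp
next
  case (Suc k)
  let ?I = "(\<lambda>j. Gap u y j) ` {..k}"
  have "(\<integral>\<^sup>+\<omega>. ennreal (exp (- c * (\<Sum>j\<le>Suc k. \<omega> (Gap u y j)))) \<partial>brw_space) =
     (\<integral>\<^sup>+\<omega>. ennreal (exp (- c * (\<Sum>j\<le>k. \<omega> (Gap u y j)))) * ennreal (exp (- c * \<omega> (Gap u y (Suc k)))) \<partial>brw_space)"
    by (intro nn_integral_cong) (simp add: ennreal_mult[symmetric] exp_add[symmetric] algebra_simps)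
  also have "\<dots> = (\<integral>\<^sup>+\<omega>. ennreal (exp (- c * (\<Sum>j\<le>k. \<omega> (Gap u y j)))) \<partial>brw_space) *
      (\<integral>\<^sup>+\<omega>. ennreal (exp (- c * \<omega> (Gap u y (Suc k)))) \<partial>brw_space)"
  proof (rule nn_integral_brw_mult)
    show "depends_on ?I (\<lambda>\<omega>. ennreal (exp (- c * (\<Sum>j\<le>k. \<omega> (Gap u y j)))))"
      unfolding depends_on_def by (auto intro!: arg_cong[where f = ennreal] arg_cong[where f = exp] sum.cong)
    show "depends_on {Gap u y (Suc k)} (\<lambda>\<omega>. ennreal (exp (- c * \<omega> (Gap u y (Suc k)))))"
      by (simp add: depends_on_def)
  qed auto
  also have "\<dots> = ennreal ((1 / (1 + c)) ^ Suc (Suc k))"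
    unfolding Suc nn_integral_clock_exp[OF assms] using assms by (simp add: ennreal_mult[symmetric])
  finally show ?case .
qed

text \<open>Let \<open>S\<close> be the age at which the root bears its \<open>k\<close>-th child at
  \<open>y\<close>, at rate \<open>r\<close>. Given \<open>S\<close>, the lifetime exceeds it with
  probability \<open>exp (- S)\<close>, so the integral is the Laplace transform of the Gamma
  variable \<open>r * S\<close> at \<open>(s + 1) / r\<close>.\<close>

lemma nn_integral_root_birth:
  assumes "0 < r" and "0 \<le> s"
  shows "(\<integral>\<^sup>+\<omega>. ennreal (exp (- s * (\<Sum>j\<le>k. \<omega> (Gap [] y j) / r))) *
      indicator {(\<Sum>j\<le>k. \<omega> (Gap [] y j) / r)<..} (\<omega> (Life [])) \<partial>brw_space)
    = ennreal ((r / (r + s + 1)) ^ Suc k)"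
proof -
  let ?S = "\<lambda>\<omega>::'a clock \<Rightarrow> real. \<Sum>j\<le>k. \<omega> (Gap [] y j) / r"
  let ?L = "\<lambda>\<omega>::'a clock \<Rightarrow> real. \<omega> (Life [])"
  let ?h = "\<lambda>p. ennreal (exp (- s * fst p)) * indicator {p. fst p < snd p} p :: ennreal"
  have [measurable]: "{p::real\<times>real. fst p < snd p} \<in> sets (borel \<Otimes>\<^sub>M borel)"
    using borel_measurable_less[of fst "borel \<Otimes>\<^sub>M borel :: (real \<times> real) measure" snd]
    by (simp add: pred_def space_pair_measure)
  have "(\<integral>\<^sup>+\<omega>. ennreal (exp (- s * ?S \<omega>)) * indicator {?S \<omega><..} (\<omega> (Life [])) \<partial>brw_space)
     = (\<integral>\<^sup>+\<omega>. ?h (?S \<omega>, \<omega> (Life [])) \<partial>brw_space)"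
    by (simp add: indicator_def)
  also have "\<dots> = (\<integral>\<^sup>+\<omega>. \<integral>\<^sup>+\<omega>'. ?h (?S \<omega>, ?L \<omega>') \<partial>brw_space \<partial>brw_space)"
  proof (rule nn_integral_brw_pair[where ?N1.0 = borel and ?N2.0 = borel])
    show "depends_on (range (Gap [] y)) ?S"
      unfolding depends_on_def by (auto intro!: sum.cong)
    show "depends_on {Life []} ?L"
      by (simp add: depends_on_def)
  qed auto
  also have "\<dots> = (\<integral>\<^sup>+\<omega>. ennreal (exp (- ((s + 1) / r) * (\<Sum>j\<le>k. \<omega> (Gap [] y j)))) \<partial>brw_space)"
  proof (rule nn_integral_cong_AE)
    \<comment> \<open>The tail formula \<open>exp (- a)\<close> requires \<open>0 \<le> a\<close>,
      and the gaps are nonnegative only almost surely.\<close>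
    have "AE \<omega> in brw_space. \<forall>j\<in>{..k}. 0 < \<omega> (Gap [] y j)"
      by (intro AE_finite_allI AE_clock_pos) simp
    then show "AE \<omega> in brw_space. (\<integral>\<^sup>+\<omega>'. ?h (?S \<omega>, ?L \<omega>') \<partial>brw_space)
      = ennreal (exp (- ((s + 1) / r) * (\<Sum>j\<le>k. \<omega> (Gap [] y j))))"
    proof eventually_elim
      case (elim \<omega>)
      have S: "0 \<le> ?S \<omega>" using elim assms by (intro sum_nonneg) (simp add: less_imp_le)
      have "(\<integral>\<^sup>+\<omega>'. ?h (?S \<omega>, ?L \<omega>') \<partial>brw_space)
        = (\<integral>\<^sup>+\<omega>'. ennreal (exp (- s * ?S \<omega>)) * indicator {?S \<omega><..} (?L \<omega>') \<partial>brw_space)"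
        by (simp add: indicator_def)
      also have "\<dots> = ennreal (exp (- s * ?S \<omega>)) * ennreal (exp (- ?S \<omega>))"
        using nn_integral_clock_tail[OF S, of "Life [] :: 'a clock"] by (subst nn_integral_cmult) auto
      also have "\<dots> = ennreal (exp (- ((s + 1) / r) * (\<Sum>j\<le>k. \<omega> (Gap [] y j))))"
        by (simp add: ennreal_mult[symmetric] exp_add[symmetric] sum_divide_distrib[symmetric]
            add_divide_distrib algebra_simps)
      finally show ?case .
    qed
  qed
  also have "\<dots> = ennreal ((r / (r + s + 1)) ^ Suc k)"
    using assms by (subst nn_integral_gap_sum) (simp_all add: field_simps)
  finally show ?thesis .
qed


section \<open>Expected number of births\<close>

text \<open>Lines of descent list the most recent birth first, so the descendants of
  \<open>w\<close> are the lists \<open>u @ w\<close>; \<open>shift w\<close> sends the clocks of a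
  whole process to those of the subtree of \<open>w\<close>.\<close>

primrec shift :: "'a particle \<Rightarrow> 'a clock \<Rightarrow> 'a clock" where
  "shift w (Life u) = Life (u @ w)"
| "shift w (Gap u y j) = Gap (u @ w) y j"

primrec owner :: "'a clock \<Rightarrow> 'a particle" where
  "owner (Life u) = u"
| "owner (Gap u y j) = u"

lemma inj_shift: "inj (shift w)"
proof (rule injI)
  fix c d assume "shift w c = shift w d"
  then show "c = d" by (cases c; cases d) auto
qed

lemma owner_shift [simp]: "owner (shift w c) = owner c @ w"
  by (cases c) auto

lemma position_append: "position x (u @ w) = position (position x w) u"
  by (cases u) auto

lemma birth_age_append:
  "birth_age \<mu> lam x \<omega> (u @ w) y k = birth_age \<mu> lam (position x w) (\<lambda>c. \<omega> (shift w c)) u y k"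
  by (simp add: birth_age_def position_append)

text \<open>Branching property: seen from \<open>w\<close>, its descendants form a process started
  at the position of \<open>w\<close> and driven by the clocks of its subtree.\<close>

lemma born_append:
  "born X \<mu> lam x \<omega> (u @ w) \<longleftrightarrow>
    born X \<mu> lam x \<omega> w \<and> born X \<mu> lam (position x w) (\<lambda>c. \<omega> (shift w c)) u"
  by (induction u) (auto simp: birth_age_append position_append)

lemma birth_time_append:
  "birth_time \<mu> lam x \<omega> (u @ w) =
    birth_time \<mu> lam x \<omega> w + birth_time \<mu> lam (position x w) (\<lambda>c. \<omega> (shift w c)) u"
  by (induction u) (auto simp: birth_age_append)

lemma born_in_lists: "born X \<mu> lam x \<omega> u \<Longrightarrow> u \<in> lists (X \<times> UNIV)"
  by (induction u) (auto simp: mem_Times_iff)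

lemma measurable_birth_age [measurable]:
  "(\<lambda>\<omega>. birth_age \<mu> lam x \<omega> u y k) \<in> borel_measurable brw_space"
  unfolding birth_age_def by measurable

lemma measurable_birth_time [measurable]:
  "(\<lambda>\<omega>. birth_time \<mu> lam x \<omega> u) \<in> borel_measurable brw_space"
  by (induction u) auto

lemma measurable_born [measurable]:
  "Measurable.pred brw_space (\<lambda>\<omega>. born X \<mu> lam x \<omega> u)"
  by (induction u) auto

lemma depends_on_shift: "depends_on (range (shift w)) (\<lambda>\<omega>. f (\<lambda>c. \<omega> (shift w c)))"
proof (unfold depends_on_def, intro allI impI)
  fix \<omega> \<omega>' :: "'a clock \<Rightarrow> 'b"
  assume "\<forall>i\<in>range (shift w). \<omega> i = \<omega>' i"
  then have "(\<lambda>c. \<omega> (shift w c)) = (\<lambda>c. \<omega>' (shift w c))" by auto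
  then show "f (\<lambda>c. \<omega> (shift w c)) = f (\<lambda>c. \<omega>' (shift w c))" by (rule arg_cong)
qed

text \<open>Only clocks of proper ancestors enter, and these have shorter lists. All clocks of the
  subtree of \<open>w\<close> have owners at least as long as \<open>w\<close>, so the birth of
  \<open>w\<close> is independent of its subtree.\<close>

lemma depends_on_born:
  "depends_on {c. length (owner c) < length w} (\<lambda>\<omega>. born X \<mu> lam x \<omega> w)"
proof (induction w)
  case Nil
  then show ?case by (simp add: depends_on_def)
next
  case (Cons p w)
  show ?case
  proof (unfold depends_on_def, intro allI impI)
    fix \<omega> \<omega>' :: "'a clock \<Rightarrow> real"
    assume eq: "\<forall>c\<in>{c. length (owner c) < length (p # w)}. \<omega> c = \<omega>' c"
    then have "birth_age \<mu> lam x \<omega> w (fst p) (snd p) = birth_age \<mu> lam x \<omega>' w (fst p) (snd p)"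
      by (simp add: birth_age_def)
    moreover from eq have "\<omega> (Life w) = \<omega>' (Life w)" by simp
    moreover from eq Cons have "born X \<mu> lam x \<omega> w = born X \<mu> lam x \<omega>' w"
      unfolding depends_on_def by simp
    ultimately show "born X \<mu> lam x \<omega> (p # w) = born X \<mu> lam x \<omega>' (p # w)" by simp
  qed
qed

text \<open>
  The Laplace transform in the birth time makes the same computation yield the expected
  number of particles (\<open>s = 0\<close>) and the absence of explosions (large \<open>s\<close>).
\<close>

definition birth_laplace ::
  "'a set \<Rightarrow> ('a \<Rightarrow> 'a \<Rightarrow> real) \<Rightarrow> real \<Rightarrow> real \<Rightarrow> 'a \<Rightarrow> ('a clock \<Rightarrow> real) \<Rightarrow> 'a particle \<Rightarrow> ennreal" where
  "birth_laplace X \<mu> lam s x \<omega> u =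
    (if born X \<mu> lam x \<omega> u then ennreal (exp (- s * birth_time \<mu> lam x \<omega> u)) else 0)"

lemma measurable_birth_laplace [measurable]:
  "(\<lambda>\<omega>. birth_laplace X \<mu> lam s x \<omega> u) \<in> borel_measurable brw_space"
  unfolding birth_laplace_def by measurable

text \<open>The last entry of the list is the child of the root, so this is a decomposition at the
  first step: the root's clocks decide the birth of that child, whose subtree is an independent copy
  started at \<open>z\<close>.\<close>

lemma nn_integral_birth_laplace_snoc:
  assumes "lam > 0" and "s \<ge> 0" and "x \<in> X" and "\<And>x y. x \<in> X \<Longrightarrow> y \<in> X \<Longrightarrow> 0 \<le> \<mu> x y"
  shows "(\<integral>\<^sup>+\<omega>. birth_laplace X \<mu> lam s x \<omega> (u @ [(z, k)]) \<partial>brw_space) =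
    indicator X z * ennreal ((lam * \<mu> x z / (lam * \<mu> x z + s + 1)) ^ Suc k) *
      (\<integral>\<^sup>+\<omega>. birth_laplace X \<mu> lam s z \<omega> u \<partial>brw_space)"
proof (cases "z \<in> X \<and> \<mu> x z > 0")
  \<comment> \<open>Without an edge to \<open>z\<close> in \<open>X\<close> the child is never born,
    and the right side vanishes too, \<open>Suc k\<close> being a positive exponent.\<close>
  case False
  then have "birth_laplace X \<mu> lam s x \<omega> (u @ [(z, k)]) = 0" for \<omega>
    by (auto simp: birth_laplace_def born_append)
  moreover have "z \<notin> X \<or> \<mu> x z = 0" using False assms(3) assms(4)[of x z] by auto
  ultimately show ?thesis by auto
next
  case True
  let ?r = "lam * \<mu> x z"
  let ?a = "\<lambda>\<omega>. \<Sum>j\<le>k. \<omega> (Gap [] z j) / ?r"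
  let ?f = "\<lambda>\<omega>. ennreal (exp (- s * ?a \<omega>)) * indicator {?a \<omega><..} (\<omega> (Life []))"
  let ?w = "[(z, k)]"
  have "?f \<in> borel_measurable brw_space"
    unfolding indicator_def by (simp, measurable)
  have "(\<integral>\<^sup>+\<omega>. birth_laplace X \<mu> lam s x \<omega> (u @ ?w) \<partial>brw_space) =
    (\<integral>\<^sup>+\<omega>. ?f \<omega> * birth_laplace X \<mu> lam s z (\<lambda>c. \<omega> (shift ?w c)) u \<partial>brw_space)"
    using True
    by (intro nn_integral_cong)
      (simp add: birth_laplace_def born_append birth_time_append birth_age_def ennreal_mult[symmetric]
        exp_add[symmetric] ring_distribs)
  also have "\<dots> = (\<integral>\<^sup>+\<omega>. ?f \<omega> \<partial>brw_space) *
      (\<integral>\<^sup>+\<omega>. birth_laplace X \<mu> lam s z (\<lambda>c. \<omega> (shift ?w c)) u \<partial>brw_space)"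
  proof (rule nn_integral_brw_mult)
    show "depends_on {c. owner c = []} ?f"
    proof (unfold depends_on_def, intro allI impI)
      fix \<omega> \<omega>' :: "'a clock \<Rightarrow> real" assume "\<forall>c\<in>{c. owner c = []}. \<omega> c = \<omega>' c"
      then have "\<omega> (Gap [] z j) = \<omega>' (Gap [] z j)" "\<omega> (Life []) = \<omega>' (Life [])" for j by auto
      then show "?f \<omega> = ?f \<omega>'" by simp
    qed
    show "{c. owner c = []} \<inter> range (shift ?w) = {}" by auto
    show "depends_on (range (shift ?w)) (\<lambda>\<omega>. birth_laplace X \<mu> lam s z (\<lambda>c. \<omega> (shift ?w c)) u)"
      by (rule depends_on_shift)
    show "(\<lambda>\<omega>. birth_laplace X \<mu> lam s z (\<lambda>c. \<omega> (shift ?w c)) u) \<in> borel_measurable brw_space"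
      by (rule measurable_compose[OF measurable_brw_reindex measurable_birth_laplace])
  qed fact
  also have "(\<integral>\<^sup>+\<omega>. birth_laplace X \<mu> lam s z (\<lambda>c. \<omega> (shift ?w c)) u \<partial>brw_space) =
      (\<integral>\<^sup>+\<omega>. birth_laplace X \<mu> lam s z \<omega> u \<partial>brw_space)"
    by (rule nn_integral_brw_reindex[OF inj_shift measurable_birth_laplace])
  also have "(\<integral>\<^sup>+\<omega>. ?f \<omega> \<partial>brw_space) = ennreal ((?r / (?r + s + 1)) ^ Suc k)"
    using True assms by (intro nn_integral_root_birth) auto
  finally show ?thesis using True by simp
qed

text \<open>Sums over all children at one vertex. With \<open>q = r / (r + s + 1)\<close> the series
  is \<open>q / (1 - q)\<close>; for \<open>s = 0\<close> it is \<open>r\<close>, the mean number of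
  children placed at rate \<open>r\<close> during a lifetime of mean 1.\<close>

lemma suminf_birth_geometric:
  assumes "0 \<le> r" and "0 \<le> s"
  shows "(\<Sum>k. ennreal ((r / (r + s + 1)) ^ Suc k)) = ennreal (r / (1 + s))"
proof -
  let ?q = "r / (r + s + 1)"
  have q: "0 \<le> ?q" "?q < 1" using assms by (simp_all add: divide_less_eq)
  have "(\<lambda>k. ?q * ?q ^ k) sums (?q * (1 / (1 - ?q)))"
    using q by (intro sums_mult geometric_sums) (simp only: real_norm_def abs_of_nonneg)
  also have "?q * (1 / (1 - ?q)) = r / (1 + s)" 
  proof -
    have "1 - ?q = (1 + s) / (r + s + 1)" using assms by (simp add: field_simps)
    then show ?thesis using assms by simp
  qed
  finally show ?thesis using q assms
    by (intro suminf_ennreal_eq) (simp_all only: power_Suc zero_le_power mult_nonneg_nonneg)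
qed

text \<open>Induction on the generation by splitting off the root's child: the sum over child
  numbers gives the factor \<open>lam * \<mu> x z / (1 + s)\<close>, and the sum over
  \<open>z\<close> reproduces the recursion of \<open>mpower\<close>.\<close>

lemma nn_integral_birth_laplace:
  assumes X: "countable X" and "lam > 0" and "s \<ge> 0"
    and "\<And>x y. x \<in> X \<Longrightarrow> y \<in> X \<Longrightarrow> 0 \<le> \<mu> x y" and "x \<in> X"
  shows "(\<integral>\<^sup>+u. indicator {u. length u = n \<and> position x u = y} u *
      (\<integral>\<^sup>+\<omega>. birth_laplace X \<mu> lam s x \<omega> u \<partial>brw_space) \<partial>count_space UNIV) =
    ennreal ((lam / (1 + s)) ^ n) * mpower X \<mu> n x y"
  using \<open>x \<in> X\<close>
proof (induction n arbitrary: x)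
  case 0
  interpret prob_space "brw_space :: ('a clock \<Rightarrow> real) measure" by (rule prob_space_brw)
  have "(\<integral>\<^sup>+u. indicator {u. length u = 0 \<and> position x u = y} u *
      (\<integral>\<^sup>+\<omega>. birth_laplace X \<mu> lam s x \<omega> u \<partial>brw_space) \<partial>count_space UNIV) =
    (\<integral>\<^sup>+u. (if x = y then 1 else 0) * indicator {[] :: 'a particle} u \<partial>count_space UNIV)"
    by (intro nn_integral_cong) (auto simp: birth_laplace_def emeasure_space_1[simplified] split: split_indicator)
  also have "\<dots> = (if x = y then 1 else 0)" by (simp add: nn_integral_cmult)
  finally show ?case by simp
next
  case (Suc n)
  define T where "T x u = (\<integral>\<^sup>+\<omega>. birth_laplace X \<mu> lam s x \<omega> u \<partial>brw_space)" for x u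
  define L where "L n x = {u. length u = n \<and> position x u = y}" for n x
  define p where "p z k = ennreal ((lam * \<mu> x z / (lam * \<mu> x z + s + 1)) ^ Suc k)" for z k
  define S where "S n x = (\<integral>\<^sup>+u. indicator (L n x) u * T x u \<partial>count_space UNIV)" for n x
  have IH: "S n z = ennreal ((lam / (1 + s)) ^ n) * mpower X \<mu> n z y" if "z \<in> X" for z
    unfolding S_def L_def T_def using that by (rule Suc.IH)
  have snoc: "indicator (L (Suc n) x) (u @ [c]) * T x (u @ [c]) =
      indicator X (fst c) * p (fst c) (snd c) * (indicator (L n (fst c)) u * T (fst c) u)" for c u
    using nn_integral_birth_laplace_snoc[where u = u and z = "fst c" and k = "snd c",
        OF assms(2,3) Suc.prems assms(4)]
    by (simp add: position_append indicator_def L_def T_def p_def)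
  \<comment> \<open>Lists are split at their last entry \<open>c\<close>, the root's child; only
    \<open>[]\<close> is missed, which has generation 0.\<close>
  have bij: "bij_betw (\<lambda>(c, u). u @ [c]) UNIV (- {[]})"
    unfolding bij_betw_def
  proof
    show "inj (\<lambda>(c, u). u @ [c])" by (auto simp: inj_def)
    show "range (\<lambda>(c, u). u @ [c]) = - {[]}"
      by (auto simp: image_iff) (metis rev_exhaust)
  qed
  have "S (Suc n) x = (\<integral>\<^sup>+u. indicator (L (Suc n) x) u * T x u \<partial>count_space (- {[]}))"
    unfolding S_def by (rule nn_integral_count_space_eq) (auto simp: L_def)
  also have "\<dots> = (\<integral>\<^sup>+q. (case q of (c, u) \<Rightarrow> indicator (L (Suc n) x) (u @ [c]) * T x (u @ [c])) \<partial>count_space UNIV)"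
    by (subst nn_integral_bij_count_space[OF bij, symmetric]) (intro nn_integral_cong, auto)
  also have "\<dots> = (\<integral>\<^sup>+c. \<integral>\<^sup>+u. indicator (L (Suc n) x) (u @ [c]) * T x (u @ [c]) \<partial>count_space UNIV \<partial>count_space UNIV)"
    by (subst nn_integral_fst_count_space[symmetric]) simp
  also have "\<dots> = (\<integral>\<^sup>+c. indicator X (fst c) * p (fst c) (snd c) * S n (fst c) \<partial>count_space UNIV)"
    unfolding snoc S_def by (intro nn_integral_cong nn_integral_cmult) simp
  also have "\<dots> = (\<integral>\<^sup>+z. \<integral>\<^sup>+k. indicator X z * p z k * S n z \<partial>count_space UNIV \<partial>count_space UNIV)"
    by (subst nn_integral_fst_count_space[symmetric]) simp
  also have "\<dots> = (\<integral>\<^sup>+z. indicator X z * S n z * (\<Sum>k. p z k) \<partial>count_space UNIV)"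
  proof (intro nn_integral_cong)
    fix z
    have "(\<integral>\<^sup>+k. indicator X z * p z k * S n z \<partial>count_space UNIV) =
        (\<integral>\<^sup>+k. indicator X z * S n z * p z k \<partial>count_space UNIV)"
      by (intro nn_integral_cong) (simp only: mult.assoc mult.commute mult.left_commute)
    also have "\<dots> = indicator X z * S n z * (\<integral>\<^sup>+k. p z k \<partial>count_space UNIV)"
      by (rule nn_integral_cmult) simp
    finally show "(\<integral>\<^sup>+k. indicator X z * p z k * S n z \<partial>count_space UNIV) =
        indicator X z * S n z * (\<Sum>k. p z k)"
      by (simp only: nn_integral_count_space_nat)
  qed
  also have "\<dots> = (\<integral>\<^sup>+z. indicator X z * S n z * (\<Sum>k. p z k) \<partial>count_space X)"
    by (rule nn_integral_count_space_eq) auto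
  also have "\<dots> = (\<integral>\<^sup>+z. ennreal ((lam / (1 + s)) ^ Suc n) * (ennreal (\<mu> x z) * mpower X \<mu> n z y) \<partial>count_space X)"
  proof (intro nn_integral_cong)
    fix z assume "z \<in> space (count_space X)"
    then have z: "z \<in> X" by simp
    have "0 \<le> lam * \<mu> x z" using assms(2,4) Suc.prems z by simp
    from suminf_birth_geometric[OF this assms(3)]
    have p: "(\<Sum>k. p z k) = ennreal (lam / (1 + s)) * ennreal (\<mu> x z)"
      using assms(2-4) Suc.prems z by (simp add: p_def ennreal_mult[symmetric])
    have e: "ennreal ((lam / (1 + s)) ^ Suc n) = ennreal ((lam / (1 + s)) ^ n) * ennreal (lam / (1 + s))"
      using assms(2,3) unfolding power_Suc2 by (intro ennreal_mult) auto
    show "indicator X z * S n z * (\<Sum>k. p z k) =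
        ennreal ((lam / (1 + s)) ^ Suc n) * (ennreal (\<mu> x z) * mpower X \<mu> n z y)"
      unfolding p e IH[OF z] using z by (simp only: indicator_simps mult_1 mult.assoc mult.commute mult.left_commute)
  qed
  also have "\<dots> = ennreal ((lam / (1 + s)) ^ Suc n) * mpower X \<mu> (Suc n) x y"
    unfolding mpower.simps infsum_eq_nn_integral_count_space[OF X] by (rule nn_integral_cmult) simp
  finally show ?case unfolding S_def L_def T_def .
qed


section \<open>Local extinction\<close>

definition locally_extinct ::
  "'a set \<Rightarrow> ('a \<Rightarrow> 'a \<Rightarrow> real) \<Rightarrow> real \<Rightarrow> 'a \<Rightarrow> ('a clock \<Rightarrow> real) \<Rightarrow> bool" where
  "locally_extinct X \<mu> lam x \<omega> \<longleftrightarrow> (\<exists>t'\<ge>0. \<forall>t\<ge>t'. brw X \<mu> lam x \<omega> t x = 0)"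

lemma brw_eq_0_iff: "brw X \<mu> lam x \<omega> t y = 0 \<longleftrightarrow> alive_at X \<mu> lam x \<omega> t y = {}"
  by (auto simp: brw_def Let_def zero_enat_def)

text \<open>Replaces the uncountably many times by conditions on birth and death times, which are
  countably many for countable \<open>X\<close>. The clause \<open>0 < \<omega> (Life u)\<close> is
  there because a particle with nonpositive lifetime is never alive.\<close>

lemma locally_extinct_iff:
  "locally_extinct X \<mu> lam x \<omega> \<longleftrightarrow> (\<exists>n::nat. \<forall>u\<in>lists (X \<times> UNIV).
    born X \<mu> lam x \<omega> u \<longrightarrow> position x u = x \<longrightarrow> 0 < \<omega> (Life u) \<longrightarrow>
      birth_time \<mu> lam x \<omega> u + \<omega> (Life u) \<le> real n)" (is "_ \<longleftrightarrow> (\<exists>n. ?B n)")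
proof
  assume "locally_extinct X \<mu> lam x \<omega>"
  then obtain t' where t': "\<And>t. t \<ge> t' \<Longrightarrow> alive_at X \<mu> lam x \<omega> t x = {}"
    by (auto simp: locally_extinct_def brw_eq_0_iff)
  obtain n :: nat where n: "t' \<le> real n" using real_arch_simple by blast
  have "?B n"
  proof (intro ballI impI, rule ccontr)
    fix u
    assume u: "born X \<mu> lam x \<omega> u" "position x u = x" "0 < \<omega> (Life u)"
      "\<not> birth_time \<mu> lam x \<omega> u + \<omega> (Life u) \<le> real n"
    \<comment> \<open>A particle dying after \<open>n\<close> is alive at the later of
      \<open>n\<close> and its birth time.\<close>
    then have "u \<in> alive_at X \<mu> lam x \<omega> (max (real n) (birth_time \<mu> lam x \<omega> u)) x"
      by (auto simp: alive_at_def)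
    with t'[of "max (real n) (birth_time \<mu> lam x \<omega> u)"] n show False by auto
  qed
  then show "\<exists>n. ?B n" ..
next
  assume "\<exists>n. ?B n"
  then obtain n where n: "?B n" ..
  have "alive_at X \<mu> lam x \<omega> t x = {}" if "t \<ge> real n" for t
  proof (rule ccontr)
    assume "alive_at X \<mu> lam x \<omega> t x \<noteq> {}"
    then obtain u where "born X \<mu> lam x \<omega> u" "position x u = x"
      "birth_time \<mu> lam x \<omega> u \<le> t" "t < birth_time \<mu> lam x \<omega> u + \<omega> (Life u)"
      by (auto simp: alive_at_def)
    with n born_in_lists[of X \<mu> lam x \<omega> u] that show False by force
  qed
  then show "locally_extinct X \<mu> lam x \<omega>"
    unfolding locally_extinct_def brw_eq_0_iff by (intro exI[of _ "real n"]) simp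
qed

lemma sets_locally_extinct:
  assumes "countable X"
  shows "{\<omega>. locally_extinct X \<mu> lam x \<omega>} \<in> sets brw_space"
proof -
  let ?A = "\<lambda>n u. {\<omega>. born X \<mu> lam x \<omega> u \<longrightarrow> position x u = x \<longrightarrow> 0 < \<omega> (Life u) \<longrightarrow>
      birth_time \<mu> lam x \<omega> u + \<omega> (Life u) \<le> real n}"
  have W: "countable (lists (X \<times> (UNIV :: nat set)))" using assms by simp
  have A: "?A n u \<in> sets brw_space" for n u
  proof -
    have "{\<omega> \<in> space brw_space. born X \<mu> lam x \<omega> u \<longrightarrow> position x u = x \<longrightarrow> 0 < \<omega> (Life u) \<longrightarrow>
      birth_time \<mu> lam x \<omega> u + \<omega> (Life u) \<le> real n} \<in> sets brw_space" by measurable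
    then show ?thesis by simp
  qed
  have UN: "UNIV \<in> sets (brw_space :: ('a clock \<Rightarrow> real) measure)"
    using sets.top[of "brw_space :: ('a clock \<Rightarrow> real) measure"] by simp
  have "{\<omega>. locally_extinct X \<mu> lam x \<omega>} = (\<Union>n. \<Inter>u\<in>lists (X \<times> UNIV). ?A n u)"
    unfolding locally_extinct_iff by blast
  also have "\<dots> \<in> sets brw_space"
    by (intro sets.countable_nat_UN image_subsetI sets.countable_INT''[OF UN W A])
  finally show ?thesis .
qed

text \<open>By hypothesis the total Laplace weight of the particles born at \<open>y\<close> has
  finite expectation, so it is almost surely finite, while each particle counted at level
  \<open>t\<close> weighs at least \<open>exp (- t)\<close>. The case \<open>s = 0\<close> concerns
  all births at \<open>y\<close>; a positive \<open>s\<close> excludes infinitely many of them in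
  bounded time.\<close>

lemma AE_finite_births:
  assumes X: "countable X" and "lam > 0" and "s \<ge> 0" and "x \<in> X"
    and "\<And>x y. x \<in> X \<Longrightarrow> y \<in> X \<Longrightarrow> 0 \<le> \<mu> x y"
    and fin: "(\<Sum>n. ennreal ((lam / (1 + s)) ^ n) * mpower X \<mu> n x y) < \<infinity>"
  shows "AE \<omega> in brw_space. \<forall>t. finite {u. born X \<mu> lam x \<omega> u \<and> position x u = y \<and>
    s * birth_time \<mu> lam x \<omega> u \<le> t}"
proof -
  define W where "W = lists (X \<times> (UNIV :: nat set))"
  define Q where "Q = {u. position x u = y}"
  let ?T = "\<lambda>u. \<integral>\<^sup>+\<omega>. birth_laplace X \<mu> lam s x \<omega> u \<partial>brw_space"
  let ?F = "\<lambda>\<omega>. \<integral>\<^sup>+u. indicator Q u * birth_laplace X \<mu> lam s x \<omega> u \<partial>count_space W"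
  have W: "countable W" using X by (simp add: W_def)
  have meas [measurable]: "?F \<in> borel_measurable brw_space"
  proof (rule sigma_finite_measure.borel_measurable_nn_integral[OF sigma_finite_measure_count_space_countable[OF W]])
    have "(\<lambda>p. indicator Q (snd p) * birth_laplace X \<mu> lam s x (fst p) (snd p))
        \<in> borel_measurable (brw_space \<Otimes>\<^sub>M count_space W)"
      by (rule measurable_compose_countable'[where g = snd and I = W and
          f = "\<lambda>u p. indicator Q u * birth_laplace X \<mu> lam s x (fst p) u"])
        (use W in \<open>auto intro!: borel_measurable_times_ennreal measurable_compose[OF measurable_fst measurable_birth_laplace]\<close>)
    then show "(\<lambda>(\<omega>, u). indicator Q u * birth_laplace X \<mu> lam s x \<omega> u)
        \<in> borel_measurable (brw_space \<Otimes>\<^sub>M count_space W)"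
      by (simp add: case_prod_beta')
  qed
  have "(\<integral>\<^sup>+\<omega>. ?F \<omega> \<partial>brw_space) =
      (\<integral>\<^sup>+u. \<integral>\<^sup>+\<omega>. indicator Q u * birth_laplace X \<mu> lam s x \<omega> u \<partial>brw_space \<partial>count_space W)"
    by (rule nn_integral_count_space_nn_integral[OF W]) measurable
  also have "\<dots> = (\<integral>\<^sup>+u. indicator Q u * ?T u \<partial>count_space W)"
    by (intro nn_integral_cong nn_integral_cmult measurable_birth_laplace)
  also have "\<dots> = (\<integral>\<^sup>+u. indicator Q u * ?T u \<partial>count_space UNIV)"
  proof (rule nn_integral_count_space_eq)
    fix u assume "u \<in> UNIV - W"
    then have "birth_laplace X \<mu> lam s x \<omega> u = 0" for \<omega>
      using born_in_lists[of X \<mu> lam x \<omega> u] by (auto simp: birth_laplace_def W_def)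
    then show "indicator Q u * ?T u = 0" by simp
  qed auto
  \<comment> \<open>Each particle belongs to exactly one generation.\<close>
  also have "\<dots> = (\<integral>\<^sup>+u. (\<Sum>n. indicator {u. length u = n \<and> position x u = y} u * ?T u) \<partial>count_space UNIV)"
  proof (rule nn_integral_cong)
    fix u :: "'a particle"
    have "(\<lambda>n. indicator {u. length u = n \<and> position x u = y} u * ?T u) sums
      (\<Sum>n\<in>{length u}. indicator {u. length u = n \<and> position x u = y} u * ?T u)"
      by (rule sums_finite) auto
    then show "indicator Q u * ?T u = (\<Sum>n. indicator {u. length u = n \<and> position x u = y} u * ?T u)"
      by (auto simp: Q_def indicator_def dest!: sums_unique)
  qed
  also have "\<dots> = (\<Sum>n. ennreal ((lam / (1 + s)) ^ n) * mpower X \<mu> n x y)"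
    by (subst nn_integral_suminf) (simp_all add: nn_integral_birth_laplace[OF X assms(2,3,5,4)])
  finally have "(\<integral>\<^sup>+\<omega>. ?F \<omega> \<partial>brw_space) \<noteq> \<infinity>" using fin by simp
  then have "AE \<omega> in brw_space. ?F \<omega> \<noteq> \<infinity>" by (rule nn_integral_PInf_AE[OF meas])
  then show ?thesis
  proof eventually_elim
    case (elim \<omega>)
    show ?case
    proof (intro allI, rule ccontr)
      fix t
      let ?A = "{u. born X \<mu> lam x \<omega> u \<and> position x u = y \<and> s * birth_time \<mu> lam x \<omega> u \<le> t}"
      assume inf: "infinite ?A"
      have A: "?A \<subseteq> W"
      proof
        fix u assume "u \<in> ?A"
        then have "born X \<mu> lam x \<omega> u" by simp
        then show "u \<in> W" unfolding W_def by (rule born_in_lists)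
      qed
      have "\<infinity> = ennreal (exp (- t)) * emeasure (count_space W) ?A"
        using inf A by (simp add: ennreal_mult_top)
      also have "\<dots> = (\<integral>\<^sup>+u. ennreal (exp (- t)) * indicator ?A u \<partial>count_space W)"
        using A by (subst nn_integral_cmult_indicator) auto
      also have "\<dots> \<le> ?F \<omega>"
        by (intro nn_integral_mono) (auto simp: birth_laplace_def Q_def split: split_indicator)
      finally show False using elim by (simp add: top.extremum_unique)
    qed
  qed
qed

text \<open>Failure of supercriticality at \<open>lam'\<close> bounds the expected births at
  \<open>x\<close> in generation \<open>n\<close> by \<open>(lam / lam') ^ n\<close>, which is
  summable. Finitely many births at \<open>x\<close> have bounded death times.\<close>

lemma prob_locally_extinct:
  assumes X: "countable X" and "lam > 0" and "x \<in> X"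
    and "\<And>x y. x \<in> X \<Longrightarrow> y \<in> X \<Longrightarrow> 0 \<le> \<mu> x y"
    and "lam < lam'" and "\<not> supercritical X \<mu> x lam'"
  shows "measure brw_space {\<omega>. locally_extinct X \<mu> lam x \<omega>} = 1"
proof -
  interpret prob_space "brw_space :: ('a clock \<Rightarrow> real) measure" by (rule prob_space_brw)
  have le: "ennreal ((lam / (1 + 0)) ^ n) * mpower X \<mu> n x x \<le> ennreal ((lam / lam') ^ n)" for n
  proof -
    have "ennreal (lam' ^ n) * mpower X \<mu> n x x \<le> 1"
      using assms(6) by (auto simp: supercritical_def not_less)
    then have "ennreal ((lam / lam') ^ n) * (ennreal (lam' ^ n) * mpower X \<mu> n x x) \<le> ennreal ((lam / lam') ^ n) * 1"
      by (intro mult_left_mono) auto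
    moreover have "ennreal ((lam / lam') ^ n) * ennreal (lam' ^ n) = ennreal ((lam / (1 + 0)) ^ n)"
      using assms(2,5) by (simp add: ennreal_mult[symmetric] power_mult_distrib[symmetric])
    ultimately show ?thesis by (simp add: mult.assoc[symmetric])
  qed
  have "(\<Sum>n. ennreal ((lam / (1 + 0)) ^ n) * mpower X \<mu> n x x) \<le> (\<Sum>n. ennreal ((lam / lam') ^ n))"
    by (intro suminf_le le) auto
  also have "\<dots> = ennreal (1 / (1 - lam / lam'))"
    using assms(2,5) by (intro suminf_ennreal_eq geometric_sums) auto
  also have "\<dots> < \<infinity>" by simp
  finally have "AE \<omega> in brw_space. \<forall>t. finite {u. born X \<mu> lam x \<omega> u \<and> position x u = x \<and>
    0 * birth_time \<mu> lam x \<omega> u \<le> t}"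
    by (intro AE_finite_births assms) auto
  then have "AE \<omega> in brw_space. locally_extinct X \<mu> lam x \<omega>"
  proof eventually_elim
    case (elim \<omega>)
    let ?A = "{u. born X \<mu> lam x \<omega> u \<and> position x u = x}"
    \<comment> \<open>Since \<open>s = 0\<close>, the level \<open>t = 0\<close> already admits
      every particle born at \<open>x\<close>.\<close>
    have "finite ((\<lambda>u. birth_time \<mu> lam x \<omega> u + \<omega> (Life u)) ` ?A)"
      using elim[rule_format, of 0] by simp
    then obtain b where b: "\<And>u. u \<in> ?A \<Longrightarrow> birth_time \<mu> lam x \<omega> u + \<omega> (Life u) \<le> b"
      by (meson bdd_above.unfold bdd_above_finite imageI)
    obtain n :: nat where "b \<le> real n" using real_arch_simple by blast
    then show ?case unfolding locally_extinct_iff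
      using b by (intro exI[of _ n]) force
  qed
  then show ?thesis
    using prob_Collect_eq_1[of "locally_extinct X \<mu> lam x"] sets_locally_extinct[OF X] by simp
qed


section \<open>Survival\<close>

lemma prob_brw_conj:
  fixes P Q :: "('a clock \<Rightarrow> real) \<Rightarrow> bool"
  assumes "Measurable.pred brw_space P" "Measurable.pred brw_space Q"
    and "depends_on I P" and "depends_on J Q" and "I \<inter> J = {}"
  shows "measure brw_space {\<omega>. P \<omega> \<and> Q \<omega>} = measure brw_space {\<omega>. P \<omega>} * measure brw_space {\<omega>. Q \<omega>}"
proof -
  have S: "{\<omega>. P \<omega>} \<in> sets brw_space" "{\<omega>. Q \<omega>} \<in> sets brw_space" "{\<omega>. P \<omega> \<and> Q \<omega>} \<in> sets brw_space"
    using assms(1,2) pred_intros_logic(3)[OF assms(1,2)] by (simp_all add: pred_def conj_commute)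
  have dep: "depends_on I (indicator {\<omega>. P \<omega>} :: _ \<Rightarrow> ennreal)" "depends_on J (indicator {\<omega>. Q \<omega>} :: _ \<Rightarrow> ennreal)"
    using assms(3,4) by (auto simp: depends_on_def indicator_def)
  have "emeasure brw_space {\<omega>. P \<omega> \<and> Q \<omega>} = (\<integral>\<^sup>+\<omega>. indicator {\<omega>. P \<omega>} \<omega> * indicator {\<omega>. Q \<omega>} \<omega> \<partial>brw_space)"
    unfolding nn_integral_indicator[OF S(3), symmetric]
    by (intro nn_integral_cong) (simp add: indicator_def)
  also have "\<dots> = emeasure brw_space {\<omega>. P \<omega>} * emeasure brw_space {\<omega>. Q \<omega>}"
    using S by (subst nn_integral_brw_mult[OF _ _ dep assms(5)]) auto
  finally show ?thesis by (simp add: measure_def enn2real_mult)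
qed

lemma prob_brw_reindex:
  fixes Q :: "('a clock \<Rightarrow> real) \<Rightarrow> bool" and \<sigma> :: "'a clock \<Rightarrow> 'a clock"
  assumes "inj \<sigma>" and "Measurable.pred brw_space Q"
  shows "measure brw_space {\<omega>. Q (\<lambda>c. \<omega> (\<sigma> c))} = measure brw_space {\<omega>. Q \<omega>}"
proof -
  have S: "{\<omega>. Q \<omega>} \<in> sets brw_space" using assms(2) by (simp add: pred_def)
  have "measure brw_space {\<omega>. Q \<omega>} = measure (distr brw_space brw_space (\<lambda>\<omega> c. \<omega> (\<sigma> c))) {\<omega>. Q \<omega>}"
    by (simp add: distr_brw_reindex[OF assms(1)])
  also have "\<dots> = measure brw_space {\<omega>. Q (\<lambda>c. \<omega> (\<sigma> c))}"
    using S by (subst measure_distr[OF measurable_brw_reindex]) (auto simp: vimage_def)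
  finally show ?thesis by simp
qed

text \<open>
  This integrates \<open>indicator (\<Union>w\<in>B. A w) \<ge> 2 t Z - t\<^sup>2 Z\<^sup>2\<close>, where \<open>Z\<close> counts the events that occur.
\<close>

lemma (in prob_space) prob_UN_ge_second_moment:
  assumes "finite B" and A: "\<And>w. w \<in> B \<Longrightarrow> A w \<in> events"
  shows "2 * t * (\<Sum>w\<in>B. prob (A w)) - t\<^sup>2 * (\<Sum>w\<in>B. \<Sum>v\<in>B. prob (A w \<inter> A v)) \<le> prob (\<Union>w\<in>B. A w)"
proof -
  let ?i = "\<lambda>w \<omega>. indicator (A w) \<omega> :: real"
  let ?Z = "\<lambda>\<omega>. \<Sum>w\<in>B. ?i w \<omega>"
  have int: "integrable M (?i w)" if "w \<in> B" for w
    using A[OF that] by (intro integrable_real_indicator) (auto simp: less_top[symmetric])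
  have int2: "integrable M (\<lambda>\<omega>. ?i w \<omega> * ?i v \<omega>)" if "w \<in> B" "v \<in> B" for w v
    unfolding indicator_inter_arith[symmetric]
    using A that by (intro integrable_real_indicator) (auto simp: less_top[symmetric])
  have e2: "expectation (\<lambda>\<omega>. ?i w \<omega> * ?i v \<omega>) = prob (A w \<inter> A v)" if "w \<in> B" "v \<in> B" for w v
    unfolding indicator_inter_arith[symmetric] using A that by simp
  have Z2: "(?Z \<omega>)\<^sup>2 = (\<Sum>w\<in>B. \<Sum>v\<in>B. ?i w \<omega> * ?i v \<omega>)" for \<omega>
    by (simp add: power2_eq_square sum_product)
  have U: "(\<Union>w\<in>B. A w) \<in> events" using assms by auto
  have "2 * t * (\<Sum>w\<in>B. prob (A w)) - t\<^sup>2 * (\<Sum>w\<in>B. \<Sum>v\<in>B. prob (A w \<inter> A v))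
      = expectation (\<lambda>\<omega>. 2 * t * ?Z \<omega> - t\<^sup>2 * (?Z \<omega>)\<^sup>2)"
    unfolding Z2 using A by (simp add: int int2 e2)
  also have "\<dots> \<le> expectation (indicator (\<Union>w\<in>B. A w))"
  proof (rule integral_mono)
    show "integrable M (\<lambda>\<omega>. 2 * t * ?Z \<omega> - t\<^sup>2 * (?Z \<omega>)\<^sup>2)"
      unfolding Z2 using A by (auto simp: int int2)
    show "integrable M (indicator (\<Union>w\<in>B. A w) :: _ \<Rightarrow> real)"
      using U by (intro integrable_real_indicator) (auto simp: less_top[symmetric])
    fix \<omega>
    have "0 \<le> (1 - t * ?Z \<omega>)\<^sup>2" by simp
    then have *: "2 * t * ?Z \<omega> - t\<^sup>2 * (?Z \<omega>)\<^sup>2 \<le> 1"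
      by (simp add: power2_diff power_mult_distrib)
    show "2 * t * ?Z \<omega> - t\<^sup>2 * (?Z \<omega>)\<^sup>2 \<le> indicator (\<Union>w\<in>B. A w) \<omega>"
    proof (cases "\<omega> \<in> (\<Union>w\<in>B. A w)")
      case False
      then have "?Z \<omega> = 0" by (intro sum.neutral) auto
      then show ?thesis using False by simp
    qed (use * in simp)
  qed
  also have "\<dots> = prob (\<Union>w\<in>B. A w)" using U by simp
  finally show ?thesis .
qed

text \<open>
  For a set \<open>B\<close> of words of equal length that lead from \<open>x\<close> back to \<open>x\<close>, the born particles that
  are concatenations of words from \<open>B\<close> form a Galton--Watson tree.
\<close>

primrec tree_survives ::
  "'a set \<Rightarrow> ('a \<Rightarrow> 'a \<Rightarrow> real) \<Rightarrow> real \<Rightarrow> 'a \<Rightarrow> 'a particle set \<Rightarrow> nat \<Rightarrow> ('a clock \<Rightarrow> real) \<Rightarrow> bool" where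
  "tree_survives X \<mu> lam x B 0 \<omega> \<longleftrightarrow> True"
| "tree_survives X \<mu> lam x B (Suc k) \<omega> \<longleftrightarrow>
    (\<exists>w\<in>B. born X \<mu> lam x \<omega> w \<and> tree_survives X \<mu> lam x B k (\<lambda>c. \<omega> (shift w c)))"

lemma measurable_tree_survives:
  assumes "finite B"
  shows "Measurable.pred brw_space (tree_survives X \<mu> lam x B k)"
proof (induction k)
  case (Suc k)
  have "Measurable.pred brw_space (\<lambda>\<omega>. tree_survives X \<mu> lam x B k (\<lambda>c. \<omega> (shift w c)))" for w
    by (rule measurable_compose[OF measurable_brw_reindex Suc])
  then show ?case
    unfolding tree_survives.simps using assms
    by (intro pred_intros_finite pred_intros_logic measurable_born)
qed simp

lemma tree_survives_Suc: "tree_survives X \<mu> lam x B (Suc k) \<omega> \<Longrightarrow> tree_survives X \<mu> lam x B k \<omega>"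
proof (induction k arbitrary: \<omega>)
  case (Suc k)
  then show ?case unfolding tree_survives.simps(2)[of _ _ _ _ _ "Suc k"] by auto
qed simp

lemma tree_survives_born:
  assumes "\<And>w. w \<in> B \<Longrightarrow> length w = n \<and> position x w = x"
  shows "tree_survives X \<mu> lam x B k \<omega> \<Longrightarrow> \<exists>u. length u = k * n \<and> position x u = x \<and> born X \<mu> lam x \<omega> u"
proof (induction k arbitrary: \<omega>)
  case 0
  then show ?case by (intro exI[of _ "[]"]) simp
next
  case (Suc k)
  then obtain w where w: "w \<in> B" "born X \<mu> lam x \<omega> w" "tree_survives X \<mu> lam x B k (\<lambda>c. \<omega> (shift w c))"
    by auto
  obtain u where u: "length u = k * n" "position x u = x" "born X \<mu> lam x (\<lambda>c. \<omega> (shift w c)) u"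
    using Suc.IH[OF w(3)] by blast
  show ?case
    using assms[OF w(1)] w(2) u by (intro exI[of _ "u @ w"]) (simp add: born_append position_append)
qed

text \<open>The second moment bound is applied to the events that \<open>w\<close> is born and its
  subtree survives \<open>k\<close> levels. The constant \<delta> is so small that the bound
  reproduces itself from level to level, in place of a fixed-point argument with generating
  functions.\<close>

lemma prob_tree_survives_ge:
  fixes B :: "'a particle set"
  assumes "finite B" and B: "\<And>w. w \<in> B \<Longrightarrow> length w = n \<and> position x w = x"
    and m: "m = (\<Sum>w\<in>B. measure brw_space {\<omega>. born X \<mu> lam x \<omega> w})"
    and C: "C = (real (card B))\<^sup>2"
    and "0 < \<delta>" and "\<delta> \<le> 1" and "\<delta> * C \<le> m - 1"
  shows "\<delta> \<le> measure brw_space {\<omega>. tree_survives X \<mu> lam x B k \<omega>}"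
proof (induction k)
  interpret prob_space "brw_space :: ('a clock \<Rightarrow> real) measure" by (rule prob_space_brw)
  case 0
  then show ?case using \<open>\<delta> \<le> 1\<close> prob_space by simp
next
  interpret prob_space "brw_space :: ('a clock \<Rightarrow> real) measure" by (rule prob_space_brw)
  case (Suc k)
  let ?s = "tree_survives X \<mu> lam x B k"
  let ?A = "\<lambda>w. {\<omega>. born X \<mu> lam x \<omega> w \<and> ?s (\<lambda>c. \<omega> (shift w c))}"
  let ?b = "\<lambda>w. prob {\<omega>. born X \<mu> lam x \<omega> w}"
  define p where "p = prob {\<omega>. ?s \<omega>}"
  have "0 < p" using Suc \<open>0 < \<delta>\<close> by (simp add: p_def)
  have ms: "Measurable.pred brw_space (\<lambda>\<omega>. ?s (\<lambda>c. \<omega> (shift w c)))" for w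
    by (rule measurable_compose[OF measurable_brw_reindex measurable_tree_survives[OF \<open>finite B\<close>]])
  have shift: "prob {\<omega>. ?s (\<lambda>c. \<omega> (shift w c))} = p" for w
    unfolding p_def by (rule prob_brw_reindex[OF inj_shift measurable_tree_survives[OF \<open>finite B\<close>]])
  have A: "?A w \<in> events" for w
    using pred_intros_logic(3)[OF measurable_born ms, of X \<mu> lam x w] by (simp add: pred_def conj_commute)
  have T: "{\<omega>. ?s (\<lambda>c. \<omega> (shift w c)) \<and> ?s (\<lambda>c. \<omega> (shift v c))} \<in> events" for v w
    using pred_intros_logic(3)[OF ms ms] by (simp add: pred_def conj_commute)
  have PA: "prob (?A w) = ?b w * p" for w
  proof -
    have "{c. length (owner c) < length w} \<inter> range (shift w) = {}" by auto
    from prob_brw_conj[OF measurable_born ms depends_on_born depends_on_shift this]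
    show ?thesis by (simp add: shift)
  qed
  \<comment> \<open>For \<open>w \<noteq> v\<close> the two births may be correlated and are simply
    dropped. Equal length makes the subtrees disjoint, so their survival events are
    independent.\<close>
  have PAA: "prob (?A w \<inter> ?A v) \<le> (if w = v then ?b w * p else 0) + p\<^sup>2" if "w \<in> B" "v \<in> B" for w v
  proof (cases "w = v")
    case True
    then show ?thesis by (simp add: PA)
  next
    case False
    have disj: "range (shift w) \<inter> range (shift v) = {}"
    proof -
      have "shift w c \<noteq> shift v d" for c d
      proof
        assume "shift w c = shift v d"
        then have "owner c @ w = owner d @ v" by (metis owner_shift)
        with B[OF that(1)] B[OF that(2)] have "w = v" by simp
        with False show False ..
      qed
      then show ?thesis by blast
    qed
    have "prob (?A w \<inter> ?A v) \<le> prob {\<omega>. ?s (\<lambda>c. \<omega> (shift w c)) \<and> ?s (\<lambda>c. \<omega> (shift v c))}"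
      by (rule finite_measure_mono) (auto simp: T)
    also have "\<dots> = p * p"
      using prob_brw_conj[OF ms ms depends_on_shift depends_on_shift disj] by (simp only: shift)
    finally show ?thesis using False by (simp add: power2_eq_square)
  qed
  have sumA: "(\<Sum>w\<in>B. prob (?A w)) = m * p" by (simp add: PA m sum_distrib_right)
  have "(\<Sum>w\<in>B. \<Sum>v\<in>B. prob (?A w \<inter> ?A v)) \<le> (\<Sum>w\<in>B. \<Sum>v\<in>B. (if w = v then ?b w * p else 0) + p\<^sup>2)"
    by (intro sum_mono PAA)
  also have "\<dots> = m * p + C * p\<^sup>2"
    using \<open>finite B\<close> by (simp add: sum.distrib m C sum_distrib_right power2_eq_square)
  finally have sumAA: "(\<Sum>w\<in>B. \<Sum>v\<in>B. prob (?A w \<inter> ?A v)) \<le> m * p + C * p\<^sup>2" .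
  \<comment> \<open>With this \<open>t\<close> the first-moment term is
    \<open>2 * \<delta> * m\<close> and the pair term \<open>\<delta>\<^sup>2 * C\<close>; the
    diagonal term \<open>\<delta>\<^sup>2 * m / p\<close> is at most \<open>\<delta> * m\<close> by
    the induction hypothesis \<open>\<delta> \<le> p\<close>. What remains is
    \<open>\<delta> * (m - \<delta> * C)\<close>, with second factor at least 1.\<close>
  let ?t = "\<delta> / p"
  have "0 \<le> m" by (simp add: m sum_nonneg)
  have "\<delta> \<le> \<delta> * (m - \<delta> * C)" using assms(5,7) by (simp add: mult_le_cancel_left1)
  also have "\<dots> = 2 * \<delta> * m - (\<delta> * m + \<delta>\<^sup>2 * C)" by (simp add: power2_eq_square algebra_simps)
  also have "\<dots> \<le> 2 * \<delta> * m - (\<delta>\<^sup>2 * m / p + \<delta>\<^sup>2 * C)"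
  proof -
    have "\<delta> * (\<delta> * m) \<le> p * (\<delta> * m)"
      using Suc \<open>0 < \<delta>\<close> \<open>0 \<le> m\<close> by (intro mult_right_mono) (auto simp: p_def)
    then have "\<delta>\<^sup>2 * m / p \<le> \<delta> * m"
      using \<open>0 < p\<close> by (simp add: pos_divide_le_eq power2_eq_square mult.assoc mult.commute[of p])
    then show ?thesis by simp
  qed
  also have "\<dots> = 2 * ?t * (m * p) - ?t\<^sup>2 * (m * p + C * p\<^sup>2)"
    using \<open>0 < p\<close> by (simp add: field_simps power2_eq_square)
  also have "\<dots> \<le> 2 * ?t * (\<Sum>w\<in>B. prob (?A w)) - ?t\<^sup>2 * (\<Sum>w\<in>B. \<Sum>v\<in>B. prob (?A w \<inter> ?A v))"
    unfolding sumA by (intro diff_left_mono mult_left_mono sumAA) simp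
  also have "\<dots> \<le> prob (\<Union>w\<in>B. ?A w)"
    by (rule prob_UN_ge_second_moment[OF \<open>finite B\<close> A])
  also have "(\<Union>w\<in>B. ?A w) = {\<omega>. tree_survives X \<mu> lam x B (Suc k) \<omega>}" by auto
  finally show ?case .
qed

text \<open>Finitely many words from \<open>x\<close> to \<open>x\<close> with mean offspring above
  1 generate a tree that survives with positive probability. Survival yields infinitely many births
  at \<open>x\<close>, and almost surely these cannot all occur in bounded time.\<close>

lemma prob_locally_extinct_less_1:
  assumes X: "countable X" and "lam > 0" and "x \<in> X"
    and "\<And>x y. x \<in> X \<Longrightarrow> y \<in> X \<Longrightarrow> 0 \<le> \<mu> x y"
    and "K < \<infinity>" and K: "\<And>x. x \<in> X \<Longrightarrow> (\<Sum>\<^sub>\<infinity>y\<in>X. ennreal (\<mu> x y)) \<le> K"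
    and super: "supercritical X \<mu> x lam"
  shows "measure brw_space {\<omega>. locally_extinct X \<mu> lam x \<omega>} < 1"
proof -
  interpret prob_space "brw_space :: ('a clock \<Rightarrow> real) measure" by (rule prob_space_brw)
  let ?b = "\<lambda>w. prob {\<omega>. born X \<mu> lam x \<omega> w}"
  obtain N where N: "1 < ennreal (lam ^ N) * mpower X \<mu> N x x"
    using super by (auto simp: supercritical_def)
  \<comment> \<open>This later makes the generations \<open>k * N\<close> infinitely many.\<close>
  have "N \<noteq> 0"
  proof
    assume "N = 0"
    with N show False by simp
  qed
  define W where "W = lists (X \<times> (UNIV :: nat set))"
  have W: "countable W" using X by (simp add: W_def)
  define L where "L = {u \<in> W. length u = N \<and> position x u = x}"
  have L: "countable L" by (rule countable_subset[OF _ W]) (auto simp: L_def)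
  have T: "(\<integral>\<^sup>+\<omega>. birth_laplace X \<mu> lam 0 x \<omega> u \<partial>brw_space) = ennreal (?b u)" for u
  proof -
    have "{\<omega>. born X \<mu> lam x \<omega> u} \<in> events"
      using measurable_born[of X \<mu> lam x u] by (simp add: pred_def)
    then have "ennreal (?b u) = (\<integral>\<^sup>+\<omega>. indicator {\<omega>. born X \<mu> lam x \<omega> u} \<omega> \<partial>brw_space)"
      by (simp add: emeasure_eq_measure)
    then show ?thesis by (simp add: birth_laplace_def indicator_def of_bool_def cong: if_cong)
  qed
  have "ennreal (lam ^ N) * mpower X \<mu> N x x =
      (\<integral>\<^sup>+u. indicator {u. length u = N \<and> position x u = x} u * ennreal (?b u) \<partial>count_space UNIV)"
    using nn_integral_birth_laplace[where \<mu> = \<mu> and n = N and y = x, OF X assms(2) order_refl assms(4,3)] by (simp add: T)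
  also have "\<dots> = (\<integral>\<^sup>+u. indicator {u. length u = N \<and> position x u = x} u * ennreal (?b u) \<partial>count_space L)"
  proof (rule nn_integral_count_space_eq)
    fix u assume u: "u \<in> UNIV - L"
    show "indicator {u. length u = N \<and> position x u = x} u * ennreal (?b u) = 0"
    proof (cases "length u = N \<and> position x u = x")
      case True
      then have "{\<omega>. born X \<mu> lam x \<omega> u} = {}"
        using u born_in_lists[of X \<mu> lam x _ u] by (auto simp: L_def W_def)
      then show ?thesis by simp
    qed simp
  qed auto
  also have "\<dots> = (\<integral>\<^sup>+u. ennreal (?b u) \<partial>count_space L)"
    by (intro nn_integral_cong) (simp add: L_def)
  \<comment> \<open>The sum is the supremum of its finite partial sums, so finitely many words
    already have mean above 1.\<close>
  also have "\<dots> = (SUP F\<in>{F. finite F \<and> F \<subseteq> L}. \<Sum>u\<in>F. ennreal (?b u))"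
    by (simp add: infsum_eq_nn_integral_count_space[OF L, symmetric] nonneg_infsum_complete)
  finally obtain B where B: "finite B" "B \<subseteq> L" "1 < (\<Sum>u\<in>B. ennreal (?b u))"
    using N by (auto simp: less_SUP_iff)
  define m where "m = (\<Sum>u\<in>B. ?b u)"
  define C where "C = (real (card B))\<^sup>2"
  \<comment> \<open>The largest value with \<open>\<delta> \<le> 1\<close> and
    \<open>\<delta> * C \<le> m - 1\<close>.\<close>
  define \<delta> where "\<delta> = min 1 ((m - 1) / C)"
  have "ennreal 1 < ennreal m" using B(3) by (simp add: m_def)
  then have "1 < m" by (simp only: ennreal_less_iff[OF zero_le_one])
  have "B \<noteq> {}" using \<open>1 < m\<close> by (auto simp: m_def)
  then have "0 < C" using B(1) by (simp add: C_def card_gt_0_iff)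
  have \<delta>: "0 < \<delta>" "\<delta> \<le> 1" "\<delta> * C \<le> m - 1"
  proof -
    have "\<delta> \<le> (m - 1) / C" by (simp add: \<delta>_def)
    then show "\<delta> * C \<le> m - 1" using \<open>0 < C\<close> by (simp add: pos_le_divide_eq)
  qed (use \<open>1 < m\<close> \<open>0 < C\<close> in \<open>auto simp: \<delta>_def\<close>)
  have BN: "length w = N \<and> position x w = x" if "w \<in> B" for w
    using that B(2) by (auto simp: L_def)
  let ?D = "\<lambda>k. {\<omega>. tree_survives X \<mu> lam x B k \<omega>}"
  have D: "?D k \<in> events" for k
    using measurable_tree_survives[OF B(1), of X \<mu> lam x k] by (simp add: pred_def)
  have "decseq ?D" unfolding decseq_Suc_iff using tree_survives_Suc by fast
  then have "(\<lambda>k. prob (?D k)) \<longlonglongrightarrow> prob (\<Inter>k. ?D k)"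
    using D by (intro finite_Lim_measure_decseq) auto
  then have survive: "\<delta> \<le> prob (\<Inter>k. ?D k)"
    using prob_tree_survives_ge[OF B(1) BN m_def C_def \<delta>] by (intro LIMSEQ_le_const) auto

  obtain r where r: "K = ennreal r" "0 \<le> r" using \<open>K < \<infinity>\<close> by (cases K) auto
  \<comment> \<open>Chosen so that \<open>lam * r / (1 + s) \<le> 1 / 2\<close>; the row-sum bound
    then makes the Laplace weights summable.\<close>
  define s where "s = 2 * lam * r"
  have "0 \<le> s" using \<open>lam > 0\<close> r by (simp add: s_def)
  have "ennreal ((lam / (1 + s)) ^ n) * mpower X \<mu> n x x \<le> ennreal ((1 / 2) ^ n)" for n
  proof -
    have q: "lam / (1 + s) * r \<le> 1 / 2"
      using \<open>0 \<le> s\<close> by (simp add: field_simps s_def)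
    have "ennreal ((lam / (1 + s)) ^ n) * mpower X \<mu> n x x \<le> ennreal ((lam / (1 + s)) ^ n) * K ^ n"
      using mpower_le_power[OF X \<open>x \<in> X\<close> \<open>x \<in> X\<close> K] by (intro mult_left_mono) auto
    also have "\<dots> = ennreal ((lam / (1 + s) * r) ^ n)"
      using \<open>lam > 0\<close> \<open>0 \<le> s\<close> r by (simp add: r ennreal_power ennreal_mult[symmetric] power_mult_distrib power_divide)
    also have "\<dots> \<le> ennreal ((1 / 2) ^ n)"
      using \<open>lam > 0\<close> \<open>0 \<le> s\<close> r q by (intro ennreal_leI power_mono) auto
    finally show ?thesis .
  qed
  then have "(\<Sum>n. ennreal ((lam / (1 + s)) ^ n) * mpower X \<mu> n x x) \<le> (\<Sum>n. ennreal ((1 / 2) ^ n))"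
    by (intro suminf_le) auto
  also have "\<dots> = ennreal (1 / (1 - 1 / 2))"
    by (intro suminf_ennreal_eq geometric_sums) auto
  also have "\<dots> < \<infinity>" by simp
  finally have "AE \<omega> in brw_space. \<forall>t. finite {u. born X \<mu> lam x \<omega> u \<and> position x u = x \<and>
      s * birth_time \<mu> lam x \<omega> u \<le> t}"
    using \<open>0 \<le> s\<close> by (intro AE_finite_births assms) auto
  moreover have "AE \<omega> in brw_space. \<forall>u\<in>W. 0 < \<omega> (Life u)"
    using AE_clock_pos by (subst AE_ball_countable[OF W]) auto
  ultimately have "AE \<omega> in brw_space. \<omega> \<in> {\<omega>. locally_extinct X \<mu> lam x \<omega>} \<longrightarrow> \<omega> \<in> UNIV - (\<Inter>k. ?D k)"
  proof eventually_elim
    case (elim \<omega>)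
    show ?case
    proof (intro impI, rule ccontr)
      assume "\<omega> \<in> {\<omega>. locally_extinct X \<mu> lam x \<omega>}" and "\<omega> \<notin> UNIV - (\<Inter>k. ?D k)"
      then obtain t' where t': "\<And>t. t \<ge> t' \<Longrightarrow> alive_at X \<mu> lam x \<omega> t x = {}"
        and surv: "\<And>k. tree_survives X \<mu> lam x B k \<omega>"
        by (auto simp: locally_extinct_def brw_eq_0_iff)
      let ?A = "{u. born X \<mu> lam x \<omega> u \<and> position x u = x}"
      \<comment> \<open>With a positive lifetime a particle is alive at its own birth time, so
        births at \<open>x\<close> end by \<open>t'\<close>.\<close>
      have "birth_time \<mu> lam x \<omega> u \<le> t'" if "u \<in> ?A" for u
      proof (rule ccontr)
        assume "\<not> birth_time \<mu> lam x \<omega> u \<le> t'"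
        moreover have "u \<in> W" using that born_in_lists[of X \<mu> lam x \<omega> u] by (simp add: W_def)
        then have "u \<in> alive_at X \<mu> lam x \<omega> (birth_time \<mu> lam x \<omega> u) x"
          using that elim(2) by (simp add: alive_at_def)
        ultimately show False using t'[of "birth_time \<mu> lam x \<omega> u"] by simp
      qed
      then have "?A \<subseteq> {u. born X \<mu> lam x \<omega> u \<and> position x u = x \<and> s * birth_time \<mu> lam x \<omega> u \<le> s * t'}"
        using \<open>0 \<le> s\<close> by (auto intro: mult_left_mono)
      then have "finite (length ` ?A)" using elim(1) by (meson finite_imageI finite_subset)
      \<comment> \<open>Survival supplies a birth at \<open>x\<close> in every generation
        \<open>k * N\<close>, contradicting finiteness.\<close>
      moreover have "range (\<lambda>k. k * N) \<subseteq> length ` ?A"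
      proof
        fix l assume "l \<in> range (\<lambda>k. k * N)"
        then obtain k where "l = k * N" by auto
        moreover obtain u where "length u = k * N" "position x u = x" "born X \<mu> lam x \<omega> u"
          using tree_survives_born[where B = B and n = N and x = x, OF BN surv[of k]] by auto
        ultimately show "l \<in> length ` ?A" by force
      qed
      moreover have "infinite (range (\<lambda>k. k * N))"
        using \<open>N \<noteq> 0\<close> by (intro range_inj_infinite) (simp add: inj_def)
      ultimately show False using finite_subset by blast
    qed
  qed
  then have "prob {\<omega>. locally_extinct X \<mu> lam x \<omega>} \<le> prob (UNIV - (\<Inter>k. ?D k))"
    by (rule finite_measure_mono_AE) (use D sets.top[of "brw_space :: ('a clock \<Rightarrow> real) measure"] in auto)
  also have "\<dots> = 1 - prob (\<Inter>k. ?D k)"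
    using prob_compl[of "\<Inter>k. ?D k"] D by auto
  also have "\<dots> < 1" using survive \<delta>(1) by simp
  finally show ?thesis .
qed


section \<open>The strong critical parameter\<close>

text \<open>Every supercritical rate has extinction probability below 1. Conversely, if the
  extinction probability at a rate is below 1, all strictly larger rates are supercritical, so the
  two sets can differ at their infimum only.\<close>

lemma strong_critical_eq:
  assumes "countable X" and "x \<in> X"
    and "\<And>x y. x \<in> X \<Longrightarrow> y \<in> X \<Longrightarrow> 0 \<le> \<mu> x y"
    and "K < \<infinity>" and "\<And>x. x \<in> X \<Longrightarrow> (\<Sum>\<^sub>\<infinity>y\<in>X. ennreal (\<mu> x y)) \<le> K"
  shows "strong_critical X \<mu> x = Inf {ereal lam | lam. lam > 0 \<and> supercritical X \<mu> x lam}" (is "_ = Inf ?S")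
proof -
  have eq: "strong_critical X \<mu> x =
      Inf {ereal lam | lam. lam > 0 \<and> measure brw_space {\<omega>. locally_extinct X \<mu> lam x \<omega>} < 1}" (is "_ = Inf ?E")
    by (simp add: strong_critical_def locally_extinct_def)
  have "?S \<subseteq> ?E" using prob_locally_extinct_less_1[where \<mu> = \<mu>, OF assms(1) _ assms(2-5)] by blast
  then have "Inf ?E \<le> Inf ?S" by (rule Inf_superset_mono)
  moreover have "Inf ?S \<le> Inf ?E"
  proof (rule Inf_greatest)
    fix z assume "z \<in> ?E"
    then obtain lam where lam: "z = ereal lam" "lam > 0"
      "measure brw_space {\<omega>. locally_extinct X \<mu> lam x \<omega>} < 1" by auto
    \<comment> \<open>The extinction result compares with strictly larger rates, so the bound is
      proved for each \<open>a > z\<close> first.\<close>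
    show "Inf ?S \<le> z"
    proof (rule dense_ge)
      fix a assume "z < a"
      then show "Inf ?S \<le> a"
      proof (cases a)
        case (real lam')
        then have "lam < lam'" using \<open>z < a\<close> lam by simp
        with prob_locally_extinct[where \<mu> = \<mu>, OF assms(1) lam(2) assms(2,3) this] lam(3)
        have "supercritical X \<mu> x lam'" by auto
        then show ?thesis using real lam \<open>lam < lam'\<close> by (intro Inf_lower) auto
      qed (use lam in auto)
    qed
  qed
  ultimately show ?thesis unfolding eq by (rule antisym)
qed

theorem theorem3p2:
  fixes X :: "'a set" and \<mu> :: "'a \<Rightarrow> 'a \<Rightarrow> real"
    and Xs Ys :: "nat \<Rightarrow> 'a set" and \<mu>s :: "nat \<Rightarrow> 'a \<Rightarrow> 'a \<Rightarrow> real"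
    and x\<^sub>0 :: 'a and y\<^sub>0 :: "nat \<Rightarrow> 'a"
  assumes "weighted_graph X \<mu>" and "connected_graph X \<mu>" and "bounded_geometry X \<mu>"
    and "(SUP x\<in>X. \<Sum>\<^sub>\<infinity>y\<in>X. ennreal (\<mu> x y)) < \<infinity>"
    and "\<And>n. finite (Xs n)" and "\<And>n. Xs n \<subseteq> Xs (Suc n)" and "(\<Union>n. Xs n) = X"
    and "\<And>n. weighted_graph (Ys n) (\<mu>s n)" and "\<And>n. connected_graph (Ys n) (\<mu>s n)"
    and "\<And>n. Xs n \<subseteq> Ys n" and "\<And>n. Ys n \<subseteq> X"
    and "\<And>n x y. x \<in> Ys n \<Longrightarrow> y \<in> Ys n \<Longrightarrow> \<mu>s n x y \<le> \<mu> x y"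
    and "\<And>x y. x \<in> X \<Longrightarrow> y \<in> X \<Longrightarrow> (\<lambda>n. \<mu>s n x y) \<longlonglongrightarrow> \<mu> x y"
    and "\<And>n. connected_graph (Xs n) \<mu>"
    and "x\<^sub>0 \<in> X" and "\<And>n. y\<^sub>0 n \<in> Ys n"
  shows "(\<forall>n. strong_critical (Ys n) (\<mu>s n) (y\<^sub>0 n) \<ge> strong_critical X \<mu> x\<^sub>0) \<and>
    (\<lambda>n. strong_critical (Ys n) (\<mu>s n) (y\<^sub>0 n)) \<longlonglongrightarrow> strong_critical X \<mu> x\<^sub>0"
proof -
  define K where "K = (SUP x\<in>X. \<Sum>\<^sub>\<infinity>y\<in>X. ennreal (\<mu> x y))"
  have "K < \<infinity>" using assms(4) by (simp add: K_def)
  have K: "(\<Sum>\<^sub>\<infinity>y\<in>X. ennreal (\<mu> x y)) \<le> K" if "x \<in> X" for x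
    unfolding K_def by (rule SUP_upper[OF that])
  have KY: "(\<Sum>\<^sub>\<infinity>y\<in>Ys n. ennreal (\<mu>s n x y)) \<le> K" if "x \<in> Ys n" for n x
  proof -
    have "(\<Sum>\<^sub>\<infinity>y\<in>Ys n. ennreal (\<mu>s n x y)) \<le> (\<Sum>\<^sub>\<infinity>y\<in>X. ennreal (\<mu> x y))"
      by (rule infsum_mono_neutral) (use assms(11)[of n] assms(12)[of _ n] that in \<open>auto intro: ennreal_leI\<close>)
    then show ?thesis using K[of x] assms(11)[of n] that by (auto intro: order_trans)
  qed
  have nonneg: "\<And>x y. x \<in> X \<Longrightarrow> y \<in> X \<Longrightarrow> 0 \<le> \<mu> x y"
    "\<And>n x y. x \<in> Ys n \<Longrightarrow> y \<in> Ys n \<Longrightarrow> 0 \<le> \<mu>s n x y"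
    using assms(1,8) by (auto simp: weighted_graph_def)
  have X: "countable X"
    unfolding assms(7)[symmetric] using assms(5) by (auto intro: countable_finite)
  have Y: "countable (Ys n)" for n using countable_subset[OF assms(11) X] .
  have ev: "eventually (\<lambda>n. x \<in> Ys n) sequentially" if x: "x \<in> X" for x
  proof -
    obtain k where k: "x \<in> Xs k" using x assms(7) by auto
    have "x \<in> Ys n" if "n \<ge> k" for n
      using lift_Suc_mono_le[of Xs, OF assms(6) that] k assms(10)[of n] by auto
    then show ?thesis by (auto simp: eventually_sequentially)
  qed
  have sX: "strong_critical X \<mu> x\<^sub>0 = Inf {ereal lam | lam. lam > 0 \<and> supercritical X \<mu> x\<^sub>0 lam}"
    using strong_critical_eq[where \<mu> = \<mu>, OF X assms(15) nonneg(1) \<open>K < \<infinity>\<close> K] by simp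
  have sY: "strong_critical (Ys n) (\<mu>s n) (y\<^sub>0 n) =
      Inf {ereal lam | lam. lam > 0 \<and> supercritical (Ys n) (\<mu>s n) (y\<^sub>0 n) lam}" for n
    using strong_critical_eq[where \<mu> = "\<mu>s n", OF Y assms(16) nonneg(2) \<open>K < \<infinity>\<close> KY] by simp
  have ge: "strong_critical X \<mu> x\<^sub>0 \<le> strong_critical (Ys n) (\<mu>s n) (y\<^sub>0 n)" for n
  proof -
    \<comment> \<open>Monotonicity compares the graphs at the common vertex
      \<open>y\<^sub>0 n\<close>; connectedness of \<open>X\<close> then moves the base to
      \<open>x\<^sub>0\<close>.\<close>
    have "supercritical X \<mu> x\<^sub>0 lam" if "lam > 0" "supercritical (Ys n) (\<mu>s n) (y\<^sub>0 n) lam" for lam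
    proof (rule supercritical_base_change[OF X assms(2) _ assms(15) that(1)])
      show "y\<^sub>0 n \<in> X" using assms(11,16)[of n] by auto
      show "supercritical X \<mu> (y\<^sub>0 n) lam"
        by (rule supercritical_mono[OF assms(11,12,16) that(2)])
    qed
    then show ?thesis unfolding sX sY by (intro Inf_superset_mono) auto
  qed
  moreover have "(\<lambda>n. strong_critical (Ys n) (\<mu>s n) (y\<^sub>0 n)) \<longlonglongrightarrow> strong_critical X \<mu> x\<^sub>0"
  proof (rule order_tendstoI)
    fix a assume "a < strong_critical X \<mu> x\<^sub>0"
    then show "eventually (\<lambda>n. a < strong_critical (Ys n) (\<mu>s n) (y\<^sub>0 n)) sequentially"
      using less_le_trans[OF _ ge] by (intro always_eventually allI)
  next
    fix a assume "strong_critical X \<mu> x\<^sub>0 < a"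
    then obtain lam where lam: "lam > 0" "supercritical X \<mu> x\<^sub>0 lam" "ereal lam < a"
      unfolding sX Inf_less_iff by auto
    \<comment> \<open>A single rate and a single exponent witness the strict inequality, so
      convergence of one diagonal entry suffices.\<close>
    obtain N where N: "1 < ennreal (lam ^ N) * mpower X \<mu> N x\<^sub>0 x\<^sub>0"
      using lam(2) by (auto simp: supercritical_def)
    have "(\<lambda>n. mpower (Ys n) (\<mu>s n) N x\<^sub>0 x\<^sub>0) \<longlonglongrightarrow> mpower X \<mu> N x\<^sub>0 x\<^sub>0"
      by (rule mpower_tendsto[OF X _ \<open>K < \<infinity>\<close> K ev assms(11,12,13,15,15)])
        (use assms(3) in \<open>auto simp: bounded_geometry_def\<close>)
    then have "(\<lambda>n. ennreal (lam ^ N) * mpower (Ys n) (\<mu>s n) N x\<^sub>0 x\<^sub>0)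
        \<longlonglongrightarrow> ennreal (lam ^ N) * mpower X \<mu> N x\<^sub>0 x\<^sub>0"
      by (intro ennreal_tendsto_cmult) auto
    then have "eventually (\<lambda>n. 1 < ennreal (lam ^ N) * mpower (Ys n) (\<mu>s n) N x\<^sub>0 x\<^sub>0) sequentially"
      using N by (rule order_tendstoD(1))
    with ev[OF assms(15)] show "eventually (\<lambda>n. strong_critical (Ys n) (\<mu>s n) (y\<^sub>0 n) < a) sequentially"
    proof eventually_elim
      case (elim n)
      then have "supercritical (Ys n) (\<mu>s n) x\<^sub>0 lam" by (auto simp: supercritical_def)
      \<comment> \<open>The base is moved inside the connected graph \<open>Ys n\<close> at the same
        \<open>lam\<close>; the exponent may change with \<open>n\<close>, but
        \<open>supercritical\<close> does not fix it.\<close>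
      then have "supercritical (Ys n) (\<mu>s n) (y\<^sub>0 n) lam"
        by (rule supercritical_base_change[OF Y assms(9) elim(1) assms(16) lam(1)])
      then have "strong_critical (Ys n) (\<mu>s n) (y\<^sub>0 n) \<le> ereal lam"
        unfolding sY using lam(1) by (intro Inf_lower) auto
      then show ?case using lam(3) by (rule le_less_trans)
    qed
  qed
  ultimately show ?thesis by blast
qed

end
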